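(* Suppose the basic assumptions (1)–(5) hold in the template matching model $Y_i = f(X_i-\theta^* )+Z_i$ with $L$ the absolute-value loss, $L(y)=|y|$. Assume, in addition, that $f$ is Lipschitz, that $\lambda$ is Lipschitz on an open set containing the support of $f(\cdot-\theta^* )$, and that $\phi$ is continuous and strictly positive at the origin. Then $\sqrt n(\hat\theta_n-\theta^* )$ is asymptotically normal (as $n\to\infty$) with mean $0$ and variance $$\tau^2 = \frac{1}{4\phi(0)^2\,\mathbb{E}[f'(X-\theta^* )^2]}.$$
   Context: Model. We observe $(X_1,Y_1),\dots,(X_n,Y_n)$ with $Y_i = f(X_i-\theta^* )+Z_i$, where $f:\mathbb{R}\to\mathbb{R}$ is a known function (the template) and $\theta^*\in\mathbb{R}$ is the unknown shift. The design points $X_i$ are iid with density $\lambda$; the noise variables $Z_i$ are iid with density $\phi$ and independent of the design points. $(X,Y)$ and $Z$ denote a generic observation and noise variable; $\mathbb{E}$ is expectation under the true shift $\theta^*$. M-estimator. Given a loss function $L:\mathbb{R}\to\mathbb{R}$, let $m_\theta(x,y) := L(y-f(x-\theta))$, $\widehat M_n(\theta) := \frac1n\sum_{i=1}^n m_\theta(X_i,Y_i)$, $M(\theta) := \mathbb{E}[m_\theta(X,Y)]$, and let $\hat\theta_n$ be a minimizer of $\widehat M_n$ over $\theta$. If $A$ is such that $f$ and $\lambda$ are both supported on $[-A,A]$, the model is $Y_i=Z_i$ for every $\theta$ outside $[-2A,2A]$, so the parameter is effectively restricted to the compact interval $[-2A,2A]$. Basic assumptions. (1) $f$ is compactly supported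 and càdlàg with none or finitely many discontinuities (in particular bounded); and for any $\theta\neq\theta^*$, $\int (f(x-\theta^* )-f(x-\theta))^2\lambda(x)\,dx>0$. (2) $\lambda$ is compactly supported. (3) $\phi$ is even. (4) $L$ is non-negative, even, non-decreasing away from the origin (i.e., on $[0,\infty)$), non-constant, and either Lipschitz or has a Lipschitz derivative (satisfied by the absolute-value loss). (5) $M$ is well-defined (finite); $\theta^*$ is the unique minimizer of $M$; and $\inf\{M(\theta):|\theta-\theta^*|\ge\delta\}>M(\theta^* )$ for every $\delta>0$. For a Lipschitz function $g$, $g'$ denotes its derivative, which exists almost everywhere and is bounded.
   Formalization: The formal theorem additionally assumes E[f'(X-θ* )²] > 0, which does not follow from the stated assumptions and without which the variance τ² is undefined (division by zero). *)

theory Defs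
  imports "HOL-Probability.Probability"
begin

definition tsupport :: "(real \<Rightarrow> real) \<Rightarrow> real set" where
  "tsupport f = closure (support_on UNIV f)"

definition cadlag :: "(real \<Rightarrow> real) \<Rightarrow> bool" where
  "cadlag f \<longleftrightarrow> (\<forall>x. continuous (at_right x) f \<and> (\<exists>l. (f \<longlongrightarrow> l) (at_left x)))"

definition obs_Y ::
  "(real \<Rightarrow> real) \<Rightarrow> real \<Rightarrow> (nat \<Rightarrow> 'w \<Rightarrow> real) \<Rightarrow> (nat \<Rightarrow> 'w \<Rightarrow> real) \<Rightarrow> nat \<Rightarrow> 'w \<Rightarrow> real"
where
  "obs_Y f \<theta>s X Z i \<omega> = f (X i \<omega> - \<theta>s) + Z i \<omega>"

definition crit :: "(real \<Rightarrow> real) \<Rightarrow> (real \<Rightarrow> real) \<Rightarrow> real \<Rightarrow> real \<Rightarrow> real \<Rightarrow> real" where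
  "crit L f \<theta> x y = L (y - f (x - \<theta>))"

text \<open>Observations are indexed from 0: the sample of size \<open>n\<close> consists of the pairs with index
  below \<open>n\<close>. The pair with index 0 also serves as the generic observation.\<close>

definition emp_crit ::
  "(real \<Rightarrow> real) \<Rightarrow> (real \<Rightarrow> real) \<Rightarrow> (nat \<Rightarrow> 'w \<Rightarrow> real) \<Rightarrow> (nat \<Rightarrow> 'w \<Rightarrow> real) \<Rightarrow>
    nat \<Rightarrow> 'w \<Rightarrow> real \<Rightarrow> real"
where
  "emp_crit L f X Y n \<omega> \<theta> = (1 / real n) * (\<Sum>i<n. crit L f \<theta> (X i \<omega>) (Y i \<omega>))"

definition pop_crit ::
  "'w measure \<Rightarrow> (real \<Rightarrow> real) \<Rightarrow> (real \<Rightarrow> real) \<Rightarrow> (nat \<Rightarrow> 'w \<Rightarrow> real) \<Rightarrow> (nat \<Rightarrow> 'w \<Rightarrow> real) \<Rightarrow>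
    real \<Rightarrow> real"
where
  "pop_crit P L f X Y \<theta> = (\<integral>\<omega>. crit L f \<theta> (X 0 \<omega>) (Y 0 \<omega>) \<partial>P)"

text \<open>Independence of the family indexed by \<open>nat + nat\<close> says that all design points and all noise
  variables are mutually independent.\<close>

locale template_model = prob_space P
  for P :: "'w measure" +
  fixes X Z :: "nat \<Rightarrow> 'w \<Rightarrow> real"
    and f lam \<phi> :: "real \<Rightarrow> real"
    and \<theta>s :: real
  assumes lam_nonneg: "\<And>x. 0 \<le> lam x"
    and phi_nonneg: "\<And>z. 0 \<le> \<phi> z"
    and X_distributed: "\<And>i. distributed P lborel (X i) (\<lambda>x. ennreal (lam x))"
    and Z_distributed: "\<And>i. distributed P lborel (Z i) (\<lambda>z. ennreal (\<phi> z))"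
    and indep: "indep_vars (\<lambda>_. borel) (case_sum X Z) UNIV"

locale basic_template_model = template_model P X Z f lam \<phi> \<theta>s
  for P :: "'w measure" and X Z f lam \<phi> \<theta>s +
  fixes L :: "real \<Rightarrow> real"
  assumes f_compact_support: "compact (tsupport f)"
    and f_cadlag: "cadlag f"
    and f_finite_discont: "finite {x. \<not> isCont f x}"
    and identifiable: "\<And>\<theta>. \<theta> \<noteq> \<theta>s \<Longrightarrow> 0 < (\<integral>x. (f (x - \<theta>s) - f (x - \<theta>))\<^sup>2 * lam x \<partial>lborel)"
    and lam_compact_support: "compact (tsupport lam)"
    and phi_even: "\<And>z. \<phi> (- z) = \<phi> z"
    and loss_nonneg: "\<And>y. 0 \<le> L y"
    and loss_even: "\<And>y. L (- y) = L y"
    and loss_mono: "mono_on {0..} L"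
    and loss_nonconst: "\<not> L constant_on UNIV"
    and loss_Lipschitz:
      "(\<exists>C. C-lipschitz_on UNIV L) \<or>
       (\<exists>L' C. (\<forall>y. (L has_real_derivative L' y) (at y)) \<and> C-lipschitz_on UNIV L')"
    and crit_integrable:
      "\<And>\<theta>. integrable P (\<lambda>\<omega>. crit L f \<theta> (X 0 \<omega>) (obs_Y f \<theta>s X Z 0 \<omega>))"
    and unique_minimizer:
      "\<And>\<theta>. is_arg_min (pop_crit P L f X (obs_Y f \<theta>s X Z)) (\<lambda>_. True) \<theta> \<longleftrightarrow> \<theta> = \<theta>s"
    and well_separated:
      "\<And>\<delta>. 0 < \<delta> \<Longrightarrow>
        (INF \<theta>\<in>{\<theta>. \<delta> \<le> \<bar>\<theta> - \<theta>s\<bar>}. pop_crit P L f X (obs_Y f \<theta>s X Z) \<theta>)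
          > pop_crit P L f X (obs_Y f \<theta>s X Z) \<theta>s"

text \<open>Weak convergence of the laws to the normal law with mean \<open>\<mu>\<close> and variance \<open>v > 0\<close>; note that
  \<open>normal_density\<close> is parametrized by the standard deviation.\<close>

definition asymp_normal :: "'w measure \<Rightarrow> (nat \<Rightarrow> 'w \<Rightarrow> real) \<Rightarrow> real \<Rightarrow> real \<Rightarrow> bool" where
  "asymp_normal P T \<mu> v \<longleftrightarrow>
     weak_conv_m (\<lambda>n. distr P borel (T n)) (density lborel (normal_density \<mu> (sqrt v)))"

end

theory Submission
  imports Defs
begin

text \<open>
  Write \<open>\<theta>s + h / \<surd>n\<close> for the parameter, so that the rescaled estimator
  \<open>\<surd>n (\<theta>hat - \<theta>s)\<close> minimizes over \<open>h\<close> the local criterion, \<open>n\<close> times the increment of the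
  empirical criterion from \<open>\<theta>s\<close> to \<open>\<theta>s + h / \<surd>n\<close>. The theorem holds because on bounded sets of
  \<open>h\<close> this local criterion is uniformly close to the random parabola \<open>h \<Delta> + (a / 2) h\<^sup>2\<close>, where
  \<open>\<Delta>\<close> is the normalized sum of the derivatives \<open>psi(X, Z) = sgn(Z) f'(X - \<theta>s)\<close> of the
  loss at \<open>\<theta>s\<close> and \<open>a\<close> is the second derivative of the population criterion at its minimum.
  The minimizer is therefore close to the vertex \<open>- \<Delta> / a\<close>
  (lemma \<open>argmin_near_quadratic_argmin\<close>), and the central limit theorem gives the limiting variance
  \<open>E[psi\<^sup>2] / a\<^sup>2\<close>. Since \<open>E[psi\<^sup>2] = E[f'(X - \<theta>s)\<^sup>2] = I\<close> and \<open>a = 2 \<phi>(0) I\<close>, this is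
  \<open>1 / (4 \<phi>(0)\<^sup>2 I)\<close>.

  The loss is not differentiable, yet its expectation is smooth at the right place:
  \<open>E|Z - u| - E|Z| = \<phi>(0) u\<^sup>2 + o(u\<^sup>2)\<close> (lemma \<open>shift_loss_expansion\<close>), and with
  \<open>u = f(x - \<theta>) - f(x - \<theta>s)\<close> dominated convergence yields the curvature \<open>2 \<phi>(0) I\<close>
  (lemma \<open>mcrit_curvature\<close>). Both this limit and the derivative \<open>psi\<close> use that the Lipschitz
  function \<open>f\<close> is differentiable almost everywhere, which is proved from the Vitali covering theorem
  (lemma \<open>lipschitz_AE_differentiable\<close>).

  Uniformity in \<open>h\<close> comes from chaining. The criterion is Lipschitz in a one-dimensional parameter,
  so the centred local process has mean square increments of order \<open>|h - h'|\<^sup>2\<close>. The dyadic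
  increments of level \<open>k\<close> then have a total mean square of order \<open>2^k 4^(-k)\<close>, and the square roots
  \<open>2^(-k/2)\<close> are summable (lemma \<open>chaining_maximal_inequality\<close>). This one inequality is used
  twice. Applied to the process itself on dyadic shells, against the quadratic growth of the population
  criterion, it shows that \<open>\<surd>n (\<theta>hat - \<theta>s)\<close> is bounded in probability (lemma \<open>root_n_rate\<close>).
  Applied to the process minus its linearization \<open>h \<Delta>\<close>, whose increments vanish in mean square
  for each fixed pair of points, it gives the uniform approximation by the parabola
  (lemma \<open>uniform_linearization\<close>). The two are combined in \<open>asymptotic_linearity\<close>.
\<close>

section \<open>Almost everywhere differentiability of Lipschitz functions\<close>

text \<open>If every point of \<open>E\<close> lies in arbitrarily short intervals that \<open>F\<close> stretches by a factor of at least
\<open>q\<close>, then \<open>F\<close> stretches \<open>E\<close> itself by that factor: the Vitali covering theorem selects disjoint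
intervals of this kind that exhaust \<open>E\<close> up to a null set, and their images are disjoint and stay in an
open set barely larger than \<open>F ` E\<close>. Stating it for a homeomorphism with inverse \<open>G\<close> makes images of
Borel sets Borel and allows the lemma to be applied to \<open>G\<close> as well, which turns the lower bound
into an upper bound.\<close>

lemma expansion_emeasure_image:
  fixes F G :: "real \<Rightarrow> real"
  assumes F: "strict_mono F" "continuous_on UNIV F" and G: "continuous_on UNIV G"
    and FG: "\<And>y. F (G y) = y" and GF: "\<And>x. G (F x) = x"
    and E: "E \<in> sets borel" and q: "0 \<le> q"
    and fine: "\<And>x d. x \<in> E \<Longrightarrow> 0 < d \<Longrightarrow>
      \<exists>a b. a < b \<and> a \<le> x \<and> x \<le> b \<and> b - a < d \<and> q * (b - a) \<le> F b - F a"
  shows "ennreal q * emeasure lborel E \<le> emeasure lborel (F ` E)"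
proof (rule ennreal_le_epsilon)
  fix e :: real assume e: "0 < e"
  have img: "F ` S = G -` S" for S
    using FG GF by (metis (no_types, lifting) image_eqI subsetI subset_antisym vimageE vimageI2 image_iff)
  have FE: "F ` E \<in> sets borel"
    unfolding img using borel_measurable_continuous_onI[OF G] E
    by (metis measurable_sets_borel)
  obtain W where W: "open W" "F ` E \<subseteq> W" "W - F ` E \<in> lmeasurable"
    "emeasure lebesgue (W - F ` E) < ennreal e"
    using sets_lebesgue_outer_open[of "F ` E" e] FE e
    by (metis sets_completionI_sets sets_lborel)
  have Wle: "emeasure lborel W \<le> emeasure lborel (F ` E) + ennreal e"
  proof -
    have "emeasure lborel W = emeasure lborel (F ` E \<union> (W - F ` E))"
      using W(2) by (simp add: Un_absorb1)
    also have "\<dots> \<le> emeasure lborel (F ` E) + emeasure lborel (W - F ` E)"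
      using FE W(1) by (intro emeasure_subadditive) auto
    also have "emeasure lborel (W - F ` E) = emeasure lebesgue (W - F ` E)"
      using FE W(1) by (simp add: emeasure_completion sets_completionI_sets)
    finally show ?thesis using W(4) by (meson add_left_mono less_imp_le order_trans)
  qed
  have U: "open (F -` W)"
    using F(2) W(1) by (simp add: open_vimage)
  \<comment> \<open>The intervals of the Vitali cover, indexed by their end points; \<open>c\<close> and \<open>r\<close> describe them as balls.\<close>
  define K where "K = {(a, b). a < b \<and> {a..b} \<subseteq> F -` W \<and> q * (b - a) \<le> F b - F a}"
  define c where "c = (\<lambda>(a, b). (a + b) / (2::real))"
  define r where "r = (\<lambda>(a, b). (b - a) / (2::real))"
  have cb: "cball (c i) (r i) = {fst i..snd i}" for i
    by (cases i) (simp add: c_def r_def cball_eq_atLeastAtMost field_simps)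
  have cover: "\<exists>i. i \<in> K \<and> x \<in> cball (c i) (r i) \<and> r i < d" if x: "x \<in> E" and d: "0 < d" for x d
  proof -
    have "x \<in> F -` W" using x W(2) by auto
    then obtain s where s: "s > 0" "ball x s \<subseteq> F -` W"
      using U by (meson open_contains_ball)
    obtain a b where ab: "a < b" "a \<le> x" "x \<le> b" "b - a < min s d" "q * (b - a) \<le> F b - F a"
      using fine[OF x, of "min s d"] s d by auto
    have "{a..b} \<subseteq> ball x s" using ab by (auto simp: dist_real_def)
    then have "(a, b) \<in> K" using ab s by (auto simp: K_def)
    moreover have "x \<in> cball (c (a, b)) (r (a, b))" using ab cb by simp
    moreover have "r (a, b) < d" using ab by (simp add: r_def)
    ultimately show ?thesis by blast
  qed
  have rpos: "0 < r i" if "i \<in> K" for i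
    using that by (cases i) (simp add: K_def r_def)
  obtain C where C: "countable C" "C \<subseteq> K"
    and disj: "pairwise (\<lambda>i j. disjnt (cball (c i) (r i)) (cball (c j) (r j))) C"
    and neg: "negligible (E - (\<Union>i\<in>C. cball (c i) (r i)))"
    by (rule Vitali_covering_theorem_cballs[of K r E c, OF rpos cover]) (rule that | assumption)+
  have CK: "fst i < snd i" "{fst i..snd i} \<subseteq> F -` W" "q * (snd i - fst i) \<le> F (snd i) - F (fst i)" if "i \<in> C" for i
  proof -
    have "i \<in> K" using C(2) that by blast
    then show "fst i < snd i" "{fst i..snd i} \<subseteq> F -` W" "q * (snd i - fst i) \<le> F (snd i) - F (fst i)"
      unfolding K_def by (cases i; simp)+
  qed
  have Fint: "F ` {a..b} = {F a..F b}" if "a < b" for a b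
  proof (intro equalityI subsetI)
    fix y assume "y \<in> {F a..F b}"
    then have "F a \<le> F (G y)" "F (G y) \<le> F b" by (auto simp: FG)
    then have "G y \<in> {a..b}" using F(1) by (simp add: strict_mono_less_eq)
    then show "y \<in> F ` {a..b}" using FG by (metis image_eqI)
  qed (use F(1) in \<open>auto simp: strict_mono_less_eq\<close>)
  have dI: "disjoint_family_on (\<lambda>i. {fst i..snd i}) C"
    using disj unfolding cb disjoint_family_on_def pairwise_def disjnt_def by blast
  have dF: "disjoint_family_on (\<lambda>i. F ` {fst i..snd i}) C"
    using dI F(1) unfolding disjoint_family_on_def
    by (metis image_Int image_empty strict_mono_eq injI)
  let ?U = "\<Union>i\<in>C. {fst i..snd i}"
  have Um: "?U \<in> sets borel" using C(1) by (intro sets.countable_UN') auto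
  have "emeasure lborel E \<le> emeasure lborel ?U"
  proof -
    have "emeasure lborel E \<le> emeasure lborel (?U \<union> (E - ?U))"
      using E Um by (intro emeasure_mono) auto
    also have "\<dots> \<le> emeasure lborel ?U + emeasure lborel (E - ?U)"
      using E Um by (intro emeasure_subadditive) auto
    also have "emeasure lborel (E - ?U) = 0"
    proof -
      have D: "E - ?U \<in> sets lborel" using E Um by simp
      then have "emeasure lebesgue (E - ?U) = 0"
        using neg unfolding cb by (simp add: negligible_iff_emeasure0 sets_completionI_sets)
      then show ?thesis using D by (simp add: emeasure_completion sets_completionI_sets)
    qed
    finally show ?thesis by simp
  qed
  also have "\<dots> = (\<integral>\<^sup>+i. emeasure lborel {fst i..snd i} \<partial>count_space C)"
    using C(1) dI by (intro emeasure_UN_countable) auto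
  finally have "ennreal q * emeasure lborel E \<le> ennreal q * \<dots>"
    by (intro mult_left_mono) auto
  also have "\<dots> = (\<integral>\<^sup>+i. ennreal q * emeasure lborel {fst i..snd i} \<partial>count_space C)"
    by (intro nn_integral_cmult[symmetric]) auto
  also have "\<dots> \<le> (\<integral>\<^sup>+i. emeasure lborel (F ` {fst i..snd i}) \<partial>count_space C)"
  proof (intro nn_integral_mono)
    fix i assume "i \<in> space (count_space C)"
    then have i: "i \<in> C" by simp
    have "F (fst i) \<le> F (snd i)" using CK(1)[OF i] F(1) by (simp add: strict_mono_less_eq less_imp_le)
    then show "ennreal q * emeasure lborel {fst i..snd i} \<le> emeasure lborel (F ` {fst i..snd i})"
      using CK[OF i] q by (simp add: Fint ennreal_mult[symmetric] ennreal_leI)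
  qed
  also have "\<dots> = emeasure lborel (\<Union>i\<in>C. F ` {fst i..snd i})"
    using C(1) dF CK(1) Fint by (intro emeasure_UN_countable[symmetric]) auto
  also have "\<dots> \<le> emeasure lborel W"
    using CK(2) W(1) by (intro emeasure_mono) auto
  finally show "ennreal q * emeasure lborel E \<le> emeasure lborel (F ` E) + ennreal e"
    using Wle by (rule order_trans)
qed

text \<open>The intervals contain \<open>x\<close> in their interior, which makes this set open. Since the inequality between
the slopes is strict, for continuous \<open>f\<close> an interval with \<open>x\<close> as an end point can be enlarged
slightly, so that no point with a large one-sided slope is lost.\<close>

definition steep_points :: "(real \<Rightarrow> real) \<Rightarrow> real \<Rightarrow> real \<Rightarrow> real set" where
  "steep_points f q d = {x. \<exists>a b. a < x \<and> x < b \<and> b - a < d \<and> q * (b - a) < f b - f a}"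

lemma open_steep_points: "open (steep_points f q d)"
proof -
  have "steep_points f q d = (\<Union>(a, b)\<in>{(a, b). b - a < d \<and> q * (b - a) < f b - f a}. {a<..<b})"
    unfolding steep_points_def by fastforce
  then show ?thesis by auto
qed

text \<open>A set on which slopes above \<open>q\<close> and slopes below \<open>p < q\<close> both occur at all scales must be null. Adding
\<open>(C + 1) x\<close> to \<open>f\<close> gives an increasing homeomorphism \<open>F\<close>, and shifts \<open>p\<close>, \<open>q\<close> to
\<open>p'\<close>, \<open>q'\<close>, which are positive unless the set is empty. The expansion lemma for \<open>F\<close> and for its inverse \<open>G\<close> bounds the measure of \<open>F ` E\<close> below by
\<open>q'\<close> and above by \<open>p'\<close> times that of \<open>E\<close>, which is impossible when \<open>E\<close> has finite positive
measure.\<close>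

lemma null_steep_and_flat:
  fixes f :: "real \<Rightarrow> real"
  assumes f: "C-lipschitz_on UNIV f" and pq: "p < q"
  shows "(\<Inter>n. steep_points f q (1 / Suc n) \<inter> steep_points (\<lambda>x. - f x) (- p) (1 / Suc n)) \<in> null_sets lborel"
    (is "?E \<in> _")
proof -
  \<comment> \<open>All slopes of \<open>F\<close> are at least 1, so it is a homeomorphism with a Lipschitz inverse.\<close>
  define F where "F x = f x + (C + 1) * x" for x
  have C: "0 \<le> C" using f lipschitz_on_nonneg by blast
  have lip: "\<bar>f x - f y\<bar> \<le> C * \<bar>x - y\<bar>" for x y
    using lipschitz_onD[OF f, of x y] by (simp add: dist_real_def)
  have slope: "y - x \<le> F y - F x" if "x \<le> y" for x y
    using lip[of y x] that unfolding F_def by (simp add: algebra_simps abs_le_iff)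
  have sm: "strict_mono F" 
    by (rule strict_monoI) (use slope in \<open>smt (verit)\<close>)
  have contf: "continuous_on UNIV f" using f lipschitz_on_continuous_on by blast
  have contF: "continuous_on UNIV F" unfolding F_def by (intro continuous_intros contf)
  have surj: "\<exists>x. F x = y" for y
  proof -
    let ?k = "\<bar>y - F 0\<bar>"
    have "F (- ?k) \<le> y" "y \<le> F ?k"
      using slope[of "- ?k" 0] slope[of 0 ?k] by linarith+
    then show ?thesis
      using IVT'[of F "- ?k" y ?k] continuous_on_subset[OF contF] by force
  qed
  then obtain G where FG: "\<And>y. F (G y) = y" by metis
  have GF: "G (F x) = x" for x using FG sm by (metis strict_mono_eq)
  have smG: "strict_mono G" 
    by (rule strict_monoI) (use FG sm in \<open>metis strict_mono_less\<close>)
  have "1-lipschitz_on UNIV G"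
  proof (rule lipschitz_onI)
    fix x y :: real
    show "dist (G x) (G y) \<le> 1 * dist x y"
      using slope[of "G x" "G y"] slope[of "G y" "G x"] by (simp add: FG dist_real_def) linarith
  qed auto
  then have contG: "continuous_on UNIV G" by (rule lipschitz_on_continuous_on)
  have E0: "?E \<in> sets borel"
    by (intro sets.countable_INT) (auto intro!: sets.Int borel_open open_steep_points)
  have bnd: "?E \<inter> {-real N..real N} \<in> null_sets lborel" for N :: nat
  proof (cases "?E \<inter> {-real N..real N} = {}")
    case False
    define E where "E = ?E \<inter> {-real N..real N}"
    define p' q' where "p' = p + C + 1" and "q' = q + C + 1"
    have E: "E \<in> sets borel" using E0 by (auto simp: E_def)
    have steep: "\<exists>a b. a < x \<and> x < b \<and> b - a < d \<and> q' * (b - a) < F b - F a"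
      and flat: "\<exists>a b. a < x \<and> x < b \<and> b - a < d \<and> F b - F a < p' * (b - a)"
      if x: "x \<in> E" and d: "0 < d" for x d
    proof -
      obtain n where n: "1 / Suc n < d" using d nat_approx_posE by blast
      have "x \<in> steep_points f q (1 / Suc n)" "x \<in> steep_points (\<lambda>x. - f x) (- p) (1 / Suc n)"
        using x unfolding E_def by auto
      then obtain a b a' b' where
        1: "a < x" "x < b" "b - a < 1 / Suc n" "q * (b - a) < f b - f a" and
        2: "a' < x" "x < b'" "b' - a' < 1 / Suc n" "- p * (b' - a') < - f b' - - f a'"
        unfolding steep_points_def by blast
      have "q' * (b - a) < F b - F a" "F b' - F a' < p' * (b' - a')"
        using 1 2 by (simp_all add: F_def p'_def q'_def algebra_simps)
      then show "\<exists>a b. a < x \<and> x < b \<and> b - a < d \<and> q' * (b - a) < F b - F a"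
        "\<exists>a b. a < x \<and> x < b \<and> b - a < d \<and> F b - F a < p' * (b - a)"
        using 1 2 n by (meson order_less_trans)+
    qed
    \<comment> \<open>As \<open>F\<close> has slopes of at least 1, a slope below \<open>p'\<close> forces \<open>p' > 1\<close>, so \<open>1 / p'\<close> is a legitimate factor for \<open>G\<close>.\<close>
    have p'1: "1 < p'"
    proof -
      obtain x where "x \<in> E" using False E_def by blast
      then obtain a b where "a < x" "x < b" "F b - F a < p' * (b - a)" using flat[of x 1] zero_less_one by blast
      then have "a < b" "F b - F a < p' * (b - a)" by auto
      then have "0 < (p' - 1) * (b - a)" using slope[of a b] by (simp add: algebra_simps)
      then show ?thesis using \<open>a < b\<close> by (simp add: zero_less_mult_iff)
    qed
    have "ennreal q' * emeasure lborel E \<le> emeasure lborel (F ` E)"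
    proof (rule expansion_emeasure_image[OF sm contF contG FG GF E])
      show "0 \<le> q'" using p'1 pq by (simp add: p'_def q'_def)
    qed (use steep in \<open>meson less_imp_le order_less_trans\<close>)
    moreover have "ennreal (1 / p') * emeasure lborel (F ` E) \<le> emeasure lborel (G ` (F ` E))"
    proof (rule expansion_emeasure_image[OF smG contG contF GF FG])
      have "F ` E = G -` E" using FG GF by (auto simp: image_iff) (metis FG)
      then show "F ` E \<in> sets borel"
        using borel_measurable_continuous_onI[OF contG] E by (metis measurable_sets_borel)
    next
      fix y d :: real assume y: "y \<in> F ` E" and d: "0 < d"
      then obtain x where x: "x \<in> E" "y = F x" by blast
      obtain a b where ab: "a < x" "x < b" "b - a < d / p'" "F b - F a < p' * (b - a)"
        using flat[OF x(1), of "d / p'"] d p'1 by auto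
      have "F a < F x" "F x < F b" using ab sm by (auto simp: strict_mono_less)
      moreover have "F b - F a < d" using ab p'1 by (simp add: field_simps)
      moreover have "1 / p' * (F b - F a) \<le> G (F b) - G (F a)"
        using ab p'1 by (simp add: GF field_simps)
      ultimately show "\<exists>a b. a < b \<and> a \<le> y \<and> y \<le> b \<and> b - a < d \<and> 1 / p' * (b - a) \<le> G b - G a"
        using x(2) by (metis less_imp_le order_less_trans)
    qed (use p'1 in auto)
    moreover have "G ` (F ` E) = E" by (auto simp: GF image_iff)
    ultimately have *: "ennreal (1 / p') * (ennreal q' * emeasure lborel E) \<le> emeasure lborel E"
      by (metis mult_left_mono order_trans zero_le)
    have fin: "emeasure lborel E < \<infinity>"
    proof -
      have "emeasure lborel E \<le> emeasure lborel {-real N..real N}"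
        by (intro emeasure_mono) (auto simp: E_def)
      then show ?thesis by (simp add: order_le_less_trans)
    qed
    then obtain s where s: "emeasure lborel E = ennreal s" "0 \<le> s"
      by (metis ennreal_cases infinity_ennreal_def less_irrefl)
    have q'1: "1 < q'" using p'1 pq by (simp add: p'_def q'_def)
    have "1 / p' * (q' * s) \<le> s"
      using * s p'1 q'1 by (simp add: ennreal_mult[symmetric])
    moreover have "1 < 1 / p' * q'" using p'1 pq by (simp add: p'_def q'_def field_simps)
    ultimately have "\<not> 0 < s"
      using mult_strict_right_mono[of 1 "1 / p' * q'" s] by (auto simp: mult.assoc)
    then have "s = 0" using s(2) by simp
    then show ?thesis using s(1) E unfolding E_def[symmetric] by (simp add: null_sets_def)
  qed simp
  have "?E = (\<Union>N. ?E \<inter> {-real N..real N})"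
  proof -
    have "(\<Union>N. {-real N..real N}) = UNIV"
      by (auto simp: abs_le_iff[symmetric] intro: real_arch_simple) (metis abs_le_iff minus_le_iff real_arch_simple)
    then show ?thesis by blast
  qed
  then show ?thesis using bnd by (metis (no_types, lifting) null_sets_UN)
qed

text \<open>Where the derivative does not exist, two rationals separate the lower limit of the difference quotients
from the upper one, so the point lies in one of countably many null sets of the preceding lemma.\<close>

lemma lipschitz_AE_differentiable:
  fixes f :: "real \<Rightarrow> real"
  assumes f: "C-lipschitz_on UNIV f"
  shows "AE x in lborel. f differentiable (at x)"
proof -
  have contf: "isCont f x" for x
    using lipschitz_on_continuous_on[OF f] by (simp add: continuous_on_eq_continuous_at)
  have lip: "\<bar>f x - f y\<bar> \<le> C * \<bar>x - y\<bar>" for x y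
    using lipschitz_onD[OF f, of x y] by (simp add: dist_real_def)
  let ?Q = "{pq :: rat \<times> rat. fst pq < snd pq}"
  let ?E = "\<lambda>(p, q). (\<Inter>n. steep_points f (of_rat q) (1 / Suc n)
                 \<inter> steep_points (\<lambda>x. - f x) (- of_rat p) (1 / Suc n))"
  have null: "(\<Union>pq\<in>?Q. ?E pq) \<in> null_sets lborel"
    using null_steep_and_flat[OF f]
    by (intro null_sets_UN') (auto simp: of_rat_less)
  have key: "x \<in> steep_points g q d"
    if freq: "\<exists>\<^sub>F y in at x. q < (g y - g x) / (y - x)" and g: "\<And>x. isCont g x" and d: "0 < d" for x g q d
  proof -
    have "\<forall>\<^sub>F y in at x. \<bar>y - x\<bar> < d \<and> y \<noteq> x"
      using d by (auto simp: eventually_at dist_real_def)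
    then have "\<exists>\<^sub>F y in at x. q < (g y - g x) / (y - x) \<and> \<bar>y - x\<bar> < d \<and> y \<noteq> x"
      using frequently_eventually_frequently[OF freq] by blast
    then obtain y where y: "q < (g y - g x) / (y - x)" "\<bar>y - x\<bar> < d" "y \<noteq> x"
      using frequently_ex by blast
    \<comment> \<open>An interval with end points \<open>x\<close> and \<open>y\<close> is steep; enlarging it by a small \<open>s\<close> on both sides puts \<open>x\<close> in its interior.\<close>
    define a b where "a = min x y" and "b = max x y"
    have ab: "a < b" "b - a < d" "a \<le> x" "x \<le> b" using y by (auto simp: a_def b_def)
    have slope: "q * (b - a) < g b - g a"
    proof (cases "x < y")
      case True then show ?thesis using y by (simp add: a_def b_def field_simps)
    next
      case False
      then have "y < x" using y by simp
      then show ?thesis using y by (simp add: a_def b_def divide_simps) (simp add: algebra_simps)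
    qed
    have gb: "((\<lambda>s. g (b + s)) \<longlongrightarrow> g b) (at_right 0)" "((\<lambda>s. g (a - s)) \<longlongrightarrow> g a) (at_right 0)"
    proof -
      have "((\<lambda>s::real. b + s) \<longlongrightarrow> b) (at_right 0)" "((\<lambda>s::real. a - s) \<longlongrightarrow> a) (at_right 0)"
        by (auto intro!: tendsto_eq_intros)
      then show "((\<lambda>s. g (b + s)) \<longlongrightarrow> g b) (at_right 0)" "((\<lambda>s. g (a - s)) \<longlongrightarrow> g a) (at_right 0)"
        using g isCont_tendsto_compose by blast+
    qed
    have "((\<lambda>s. g (b + s) - g (a - s) - q * ((b + s) - (a - s))) \<longlongrightarrow> g b - g a - q * ((b + 0) - (a - 0))) (at_right 0)"
      by (intro tendsto_intros gb)
    then have 1: "\<forall>\<^sub>F s in at_right 0. 0 < g (b + s) - g (a - s) - q * ((b + s) - (a - s))"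
      using slope by (intro order_tendstoD) auto
    have "((\<lambda>s. (b + s) - (a - s)) \<longlongrightarrow> (b + 0) - (a - 0)) (at_right (0::real))"
      by (intro tendsto_intros)
    then have 2: "\<forall>\<^sub>F s in at_right 0. (b + s) - (a - s) < d"
      using ab by (intro order_tendstoD) auto
    have 3: "\<forall>\<^sub>F s in at_right (0::real). 0 < s" by (simp add: eventually_at_right_less)
    have "\<forall>\<^sub>F s in at_right 0. 0 < g (b + s) - g (a - s) - q * ((b + s) - (a - s)) \<and> (b + s) - (a - s) < d \<and> 0 < s"
      using 1 2 3 by eventually_elim auto
    then obtain s where s: "0 < g (b + s) - g (a - s) - q * ((b + s) - (a - s))" "(b + s) - (a - s) < d" "0 < s"
      using eventually_happens trivial_limit_at_right_real by blast
    show ?thesis unfolding steep_points_def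
      using s ab by (intro CollectI exI[of _ "a - s"] exI[of _ "b + s"]) auto
  qed
  have "f differentiable (at x)" if x: "x \<notin> (\<Union>pq\<in>?Q. ?E pq)" for x
  proof (rule ccontr)
    assume nd: "\<not> f differentiable (at x)"
    let ?s = "\<lambda>y. (f y - f x) / (y - x)"
    let ?L = "Liminf (at x) (\<lambda>y. ereal (?s y))" and ?U = "Limsup (at x) (\<lambda>y. ereal (?s y))"
    have s_bd: "\<bar>?s y\<bar> \<le> C" for y
      using lip[of y x] lipschitz_on_nonneg[OF f] by (cases "y = x") (auto simp: divide_simps)
    have LU: "?L \<le> ?U" by (intro Liminf_le_Limsup) auto
    have "?L \<noteq> ?U"
    proof
      assume eq: "?L = ?U"
      then have lim: "((\<lambda>y. ereal (?s y)) \<longlongrightarrow> ?L) (at x)"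
        using tendsto_iff_Liminf_eq_Limsup[of "at x"] by auto
      have s_le: "- C \<le> ?s y" "?s y \<le> C" for y
        using s_bd[of y] by (simp_all only: abs_le_iff) linarith
      have "?L \<le> ereal C"
        by (rule tendsto_upperbound[OF lim always_eventually]) (use s_le in simp_all)
      moreover have "ereal (- C) \<le> ?L"
        by (rule tendsto_lowerbound[OF lim always_eventually]) (use s_le in simp_all)
      ultimately obtain l where "?L = ereal l" by (cases ?L) auto
      then have "(?s \<longlongrightarrow> l) (at x)" using lim by simp
      then have "(f has_field_derivative l) (at x)" by (simp add: has_field_derivative_iff)
      then show False using nd real_differentiable_def by blast
    qed
    then have less: "?L < ?U" using LU by simp
    then obtain p0 where p0: "?L < ereal p0" "ereal p0 < ?U" using ereal_dense2 by blast
    obtain q0 where q0: "ereal p0 < ereal q0" "ereal q0 < ?U" using ereal_dense2[OF p0(2)] by blast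
    obtain p where p: "p0 < of_rat p" "of_rat p < (p0 + q0) / 2"
      using of_rat_dense[of p0 "(p0 + q0) / 2"] q0 by auto
    obtain q where q: "(p0 + q0) / 2 < of_rat q" "of_rat q < q0"
      using of_rat_dense[of "(p0 + q0) / 2" q0] q0 by auto
    have "?L < ereal (of_rat p)" using order_less_trans[OF p0(1), of "ereal (of_rat p)"] p(1) by simp
    then have "\<exists>\<^sub>F y in at x. ereal (?s y) < ereal (of_rat p)"
      using Liminf_bounded[of "ereal (of_rat p)" "\<lambda>y. ereal (?s y)" "at x"]
      unfolding frequently_def not_less by (meson leD)
    then have fp: "\<exists>\<^sub>F y in at x. - of_rat p < (- f y - - f x) / (y - x)"
      by (rule frequently_elim1) (simp add: minus_divide_left[symmetric] diff_divide_distrib)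
    have "ereal (of_rat q) < ?U" using order_less_trans[OF _ q0(2), of "ereal (of_rat q)"] q(2) by simp
    then have "\<exists>\<^sub>F y in at x. ereal (of_rat q) < ereal (?s y)"
      using Limsup_bounded[of "\<lambda>y. ereal (?s y)" "ereal (of_rat q)" "at x"]
      unfolding frequently_def not_less by (meson leD)
    then have fq: "\<exists>\<^sub>F y in at x. of_rat q < ?s y" by simp
    have "x \<in> ?E (p, q)"
      using key[OF fq contf] key[OF fp] contf by auto
    moreover have "p < q" using p q by (metis of_rat_less order_less_trans)
    ultimately show False using x by (metis (mono_tags, lifting) UN_I fst_conv mem_Collect_eq snd_conv)
  qed
  then have "{x \<in> space lborel. \<not> f differentiable (at x)} \<subseteq> (\<Union>pq\<in>?Q. ?E pq)" by blast
  then show ?thesis by (rule AE_I'[OF null])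
qed

section \<open>A chaining maximal inequality\<close>

text \<open>The dyadic approximations of \<open>t\<close> from below move, from one level to the next, either not at all or by
exactly one dyadic step of the finer level. Bounding that step by the square root of the sum of squares over
all steps of its level makes the bound independent of \<open>t\<close>.\<close>

lemma dyadic_chaining:
  fixes w :: "real \<Rightarrow> real"
  assumes w: "continuous_on {0..1} w" and t: "t \<in> {0..1}"
  shows "ennreal \<bar>w t - w 0\<bar> \<le>
    (\<Sum>k. ennreal (sqrt (\<Sum>i<2 ^ k. (w ((real i + 1) / 2 ^ k) - w (real i / 2 ^ k))\<^sup>2)))"
proof -
  define D where "D k i = w ((real i + 1) / 2 ^ k) - w (real i / 2 ^ k)" for k i :: nat
  define S where "S k = sqrt (\<Sum>i<2 ^ k. (D k i)\<^sup>2)" for k :: nat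
  \<comment> \<open>The dyadic approximation of \<open>t\<close> from below at level \<open>n\<close> is \<open>j n / 2 ^ n\<close>. At level 0 it is 0, except that it is 1 for \<open>t = 1\<close>.\<close>
  define j where "j n = nat \<lfloor>2 ^ n * t\<rfloor>" for n :: nat
  have t01: "0 \<le> t" "t \<le> 1" using t by auto
  have S0: "0 \<le> S k" for k by (simp add: S_def sum_nonneg)
  have DS: "\<bar>D k i\<bar> \<le> S k" if "i < 2 ^ k" for k i
    unfolding S_def using that
    by (intro real_le_rsqrt) (auto intro!: member_le_sum[where f="\<lambda>i. (D k i)\<^sup>2"])
  have j: "real (j n) \<le> 2 ^ n * t" "2 ^ n * t < real (j n) + 1" for n
    using t01 unfolding j_def by (auto simp: of_nat_nat)
  have j_le: "j n \<le> 2 ^ n" for n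
  proof -
    have "real (j n) \<le> 2 ^ n" using j(1)[of n] t01 by (smt (verit) mult_left_le zero_le_power)
    then show ?thesis by (metis of_nat_le_iff of_nat_numeral of_nat_power)
  qed
  have bound: "\<bar>w (j n / 2 ^ n) - w 0\<bar> \<le> (\<Sum>k\<le>n. S k)" for n
  proof (induction n)
    case 0
    have "j 0 = 0 \<or> j 0 = 1" using j_le[of 0] by auto
    moreover have "w 1 - w 0 = D 0 0" by (simp add: D_def)
    ultimately show ?case using DS[of 0 0] S0[of 0] by auto
  next
    case (Suc n)
    have "real (2 * j n) < real (j (Suc n)) + 1" "real (j (Suc n)) < real (2 * j n + 2)"
      using j[of n] j[of "Suc n"] by (simp_all add: algebra_simps)
    then have "j (Suc n) = 2 * j n \<or> j (Suc n) = 2 * j n + 1" by linarith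
    then have "\<bar>w (j (Suc n) / 2 ^ Suc n) - w (j n / 2 ^ n)\<bar> \<le> S (Suc n)"
    proof
      assume *: "j (Suc n) = 2 * j n + 1"
      then have "2 * j n < 2 ^ Suc n" using j_le[of "Suc n"] by simp
      moreover have "w (j (Suc n) / 2 ^ Suc n) - w (j n / 2 ^ n) = D (Suc n) (2 * j n)"
        by (simp add: * D_def algebra_simps)
      ultimately show ?thesis using DS by metis
    qed (simp add: S0)
    then show ?case using Suc.IH by simp
  qed
  have lim: "(\<lambda>n. j n / 2 ^ n) \<longlonglongrightarrow> t"
  proof (rule LIMSEQ_I)
    fix r :: real assume "0 < r"
    then obtain N where N: "(1/2) ^ N < r" using real_arch_pow_inv[of r "1/2"] by auto
    have "norm (j n / 2 ^ n - t) < r" if "n \<ge> N" for n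
    proof -
      have "\<bar>j n / 2 ^ n - t\<bar> \<le> (1/2) ^ n"
      proof -
        have "j n / 2 ^ n \<le> t" "t < j n / 2 ^ n + 1 / 2 ^ n" using j[of n] by (simp_all add: field_simps)
        then show ?thesis by (simp add: power_one_over)
      qed
      also have "\<dots> \<le> (1/2) ^ N" using that by (intro power_decreasing) auto
      finally show ?thesis using N by simp
    qed
    then show "\<exists>no. \<forall>n\<ge>no. norm (j n / 2 ^ n - t) < r" by blast
  qed
  have "j n / 2 ^ n \<in> {0..1}" for n
    using j_le[of n] by (simp add: divide_le_eq)
  then have "(\<lambda>n. w (j n / 2 ^ n)) \<longlonglongrightarrow> w t"
    by (intro continuous_on_tendsto_compose[OF w lim t]) auto
  then have "(\<lambda>n. ennreal \<bar>w (j n / 2 ^ n) - w 0\<bar>) \<longlonglongrightarrow> ennreal \<bar>w t - w 0\<bar>"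
    by (intro tendsto_ennrealI tendsto_intros)
  moreover have "ennreal \<bar>w (j n / 2 ^ n) - w 0\<bar> \<le> (\<Sum>k. ennreal (S k))" for n
  proof -
    have "ennreal \<bar>w (j n / 2 ^ n) - w 0\<bar> \<le> ennreal (\<Sum>k\<le>n. S k)"
      using bound by (rule ennreal_leI)
    also have "\<dots> = (\<Sum>k\<le>n. ennreal (S k))" using S0 by (simp add: sum_ennreal)
    also have "\<dots> \<le> (\<Sum>k. ennreal (S k))" by (intro sum_le_suminf) auto
    finally show ?thesis .
  qed
  ultimately show ?thesis
    unfolding S_def D_def by (intro LIMSEQ_le_const2[where X="\<lambda>n. ennreal \<bar>w (j n / 2 ^ n) - w 0\<bar>"]) blast+
qed

lemma (in prob_space) expectation_sqrt_le:
  fixes Y :: "'a \<Rightarrow> real"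
  assumes Y: "integrable M Y" "\<And>x. 0 \<le> Y x"
  shows "integrable M (\<lambda>x. sqrt (Y x))" "expectation (\<lambda>x. sqrt (Y x)) \<le> sqrt (expectation Y)"
proof -
  have sq: "integrable M (\<lambda>x. (sqrt (Y x))\<^sup>2)" "expectation (\<lambda>x. (sqrt (Y x))\<^sup>2) = expectation Y"
    using Y by simp_all
  have meas: "(\<lambda>x. sqrt (Y x)) \<in> borel_measurable M" using Y(1) by measurable
  show int: "integrable M (\<lambda>x. sqrt (Y x))"
    by (rule square_integrable_imp_integrable[OF meas sq(1)])
  have "0 \<le> variance (\<lambda>x. sqrt (Y x))" by (rule variance_positive)
  also have "\<dots> = expectation Y - (expectation (\<lambda>x. sqrt (Y x)))\<^sup>2"
    using variance_eq[OF int sq(1)] sq(2) by simp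
  finally show "expectation (\<lambda>x. sqrt (Y x)) \<le> sqrt (expectation Y)"
    by (intro real_le_rsqrt) simp
qed

text \<open>The exceptional event is that the chaining series, a measurable random variable, reaches \<open>e\<close>; its
expectation is at most the sum of the \<open>v k\<close> by Jensen's inequality at each level. Working with an
exceptional event avoids the question whether the supremum over the uncountable interval is measurable.\<close>

lemma (in prob_space) chaining_maximal_inequality:
  fixes W :: "real \<Rightarrow> 'a \<Rightarrow> real"
  assumes meas: "\<And>t. W t \<in> borel_measurable M"
    and cont: "\<And>\<omega>. \<omega> \<in> space M \<Longrightarrow> continuous_on UNIV (\<lambda>t. W t \<omega>)"
    and int: "\<And>s t. integrable M (\<lambda>\<omega>. (W s \<omega> - W t \<omega>)\<^sup>2)"
    and v: "\<And>k. (\<Sum>i<2 ^ k. expectation (\<lambda>\<omega>. (W (L * (real i + 1) / 2 ^ k) \<omega> - W (L * real i / 2 ^ k) \<omega>)\<^sup>2)) \<le> (v k)\<^sup>2"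
    and v0: "\<And>k. 0 \<le> v k" and sv: "summable v" and e: "0 < e"
  shows "\<exists>A\<in>events. prob A \<le> suminf v / e \<and>
    (\<forall>\<omega>\<in>space M - A. \<forall>t\<in>{0..1}. \<bar>W (L * t) \<omega> - W 0 \<omega>\<bar> < e)"
proof -
  define Y where "Y k \<omega> = (\<Sum>i<2 ^ k. (W (L * (real i + 1) / 2 ^ k) \<omega> - W (L * real i / 2 ^ k) \<omega>)\<^sup>2)" for k :: nat and \<omega>
  define S where "S \<omega> = (\<Sum>k. ennreal (sqrt (Y k \<omega>)))" for \<omega>
  have Y0: "0 \<le> Y k \<omega>" for k \<omega> by (simp add: Y_def sum_nonneg)
  have Yint: "integrable M (Y k)" for k unfolding Y_def by (intro Bochner_Integration.integrable_sum int)
  have [measurable]: "S \<in> borel_measurable M"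
    unfolding S_def Y_def using meas by measurable
  have EY: "expectation (Y k) \<le> (v k)\<^sup>2" for k
    unfolding Y_def using v by (subst Bochner_Integration.integral_sum) (auto intro: int)
  have "(\<integral>\<^sup>+\<omega>. S \<omega> \<partial>M) = (\<Sum>k. \<integral>\<^sup>+\<omega>. ennreal (sqrt (Y k \<omega>)) \<partial>M)"
    unfolding S_def using Yint by (intro nn_integral_suminf) auto
  also have "\<dots> \<le> (\<Sum>k. ennreal (v k))"
  proof (intro suminf_le summableI)
    fix k
    have "(\<integral>\<^sup>+\<omega>. ennreal (sqrt (Y k \<omega>)) \<partial>M) = ennreal (expectation (\<lambda>\<omega>. sqrt (Y k \<omega>)))"
      using expectation_sqrt_le(1)[OF Yint Y0] Y0 by (intro nn_integral_eq_integral) auto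
    also have "\<dots> \<le> ennreal (sqrt ((v k)\<^sup>2))"
      using expectation_sqrt_le(2)[OF Yint Y0] EY[of k]
      by (intro ennreal_leI) (meson order_trans real_sqrt_le_mono)
    finally show "(\<integral>\<^sup>+\<omega>. ennreal (sqrt (Y k \<omega>)) \<partial>M) \<le> ennreal (v k)" using v0 by simp
  qed
  also have "\<dots> = ennreal (suminf v)" using v0 sv by (intro suminf_ennreal2) auto
  finally have ES: "(\<integral>\<^sup>+\<omega>. S \<omega> \<partial>M) \<le> ennreal (suminf v)" .
  define A where "A = {\<omega> \<in> space M. ennreal e \<le> S \<omega>}"
  have A: "A \<in> events" unfolding A_def by measurable
  have "ennreal e * emeasure M A \<le> (\<integral>\<^sup>+\<omega>. S \<omega> \<partial>M)"
  proof -
    have "ennreal e * emeasure M A = (\<integral>\<^sup>+\<omega>. ennreal e * indicator A \<omega> \<partial>M)"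
      using A by (simp add: nn_integral_cmult_indicator)
    also have "\<dots> \<le> (\<integral>\<^sup>+\<omega>. S \<omega> \<partial>M)"
      by (intro nn_integral_mono) (auto simp: A_def indicator_def)
    finally show ?thesis .
  qed
  then have "ennreal (e * prob A) \<le> ennreal (suminf v)"
    using ES e by (simp add: emeasure_eq_measure ennreal_mult)
  then have "e * prob A \<le> suminf v" using suminf_nonneg[OF sv v0] by simp
  then have pA: "prob A \<le> suminf v / e" using e by (simp add: field_simps)
  have "\<bar>W (L * t) \<omega> - W 0 \<omega>\<bar> < e" if \<omega>: "\<omega> \<in> space M - A" and t: "t \<in> {0..1}" for \<omega> t
  proof -
    have "continuous_on {0..1} (\<lambda>t. W (L * t) \<omega>)"
      using continuous_on_compose2[OF cont[of \<omega>], of "{0..1}" "\<lambda>t. L * t"] \<omega>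
      by (auto intro!: continuous_intros)
    from dyadic_chaining[OF this t] have "ennreal \<bar>W (L * t) \<omega> - W 0 \<omega>\<bar> \<le> S \<omega>"
      by (simp add: S_def Y_def)
    also have "\<dots> < ennreal e" using \<omega> by (auto simp: A_def)
    finally show ?thesis by (simp add: ennreal_less_iff)
  qed
  then show ?thesis using A pA by blast
qed

lemma (in prob_space) two_sided_maximal_inequality:
  fixes W :: "real \<Rightarrow> 'a \<Rightarrow> real"
  assumes meas: "\<And>t. W t \<in> borel_measurable M"
    and cont: "\<And>\<omega>. \<omega> \<in> space M \<Longrightarrow> continuous_on UNIV (\<lambda>t. W t \<omega>)"
    and zero: "\<And>\<omega>. \<omega> \<in> space M \<Longrightarrow> W 0 \<omega> = 0"
    and int: "\<And>s t. integrable M (\<lambda>\<omega>. (W s \<omega> - W t \<omega>)\<^sup>2)"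
    and v: "\<And>k s. s \<in> {L, - L} \<Longrightarrow>
      (\<Sum>i<2 ^ k. expectation (\<lambda>\<omega>. (W (s * (real i + 1) / 2 ^ k) \<omega> - W (s * real i / 2 ^ k) \<omega>)\<^sup>2)) \<le> (v k)\<^sup>2"
    and v0: "\<And>k. 0 \<le> v k" and sv: "summable v" and e: "0 < e" and L: "0 < L"
  shows "\<exists>A\<in>events. prob A \<le> 2 * suminf v / e \<and> (\<forall>\<omega>\<in>space M - A. \<forall>t. \<bar>t\<bar> \<le> L \<longrightarrow> \<bar>W t \<omega>\<bar> < e)"
proof -
  obtain A where A: "A \<in> events" "prob A \<le> suminf v / e"
    "\<And>\<omega> t. \<omega> \<in> space M - A \<Longrightarrow> t \<in> {0..1} \<Longrightarrow> \<bar>W (L * t) \<omega> - W 0 \<omega>\<bar> < e"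
    using chaining_maximal_inequality[OF meas cont int v v0 sv e, of L] by blast
  obtain B where B: "B \<in> events" "prob B \<le> suminf v / e"
    "\<And>\<omega> t. \<omega> \<in> space M - B \<Longrightarrow> t \<in> {0..1} \<Longrightarrow> \<bar>W (- L * t) \<omega> - W 0 \<omega>\<bar> < e"
    using chaining_maximal_inequality[OF meas cont int v v0 sv e, of "- L"] by blast
  have "prob (A \<union> B) \<le> 2 * suminf v / e"
    using measure_Un_le[OF A(1) B(1)] A(2) B(2) by simp
  moreover have "\<bar>W t \<omega>\<bar> < e" if \<omega>: "\<omega> \<in> space M - (A \<union> B)" and t: "\<bar>t\<bar> \<le> L" for \<omega> t
  proof (cases "0 \<le> t")
    case True
    then have "t / L \<in> {0..1}" using t L by (simp add: field_simps)
    then show ?thesis using A(3)[of \<omega> "t / L"] \<omega> L zero[of \<omega>] by simp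
  next
    case False
    then have "- t / L \<in> {0..1}" using t L by (simp add: field_simps)
    then show ?thesis using B(3)[of \<omega> "- t / L"] \<omega> L zero[of \<omega>] by simp
  qed
  ultimately show ?thesis using A(1) B(1) by blast
qed

section \<open>Slutsky's theorem and sums over an independent sample\<close>

lemma cmod_iexp_diff_le: "cmod (iexp x - iexp y) \<le> \<bar>x - y\<bar>"
proof -
  have "iexp x - iexp y = iexp y * (iexp (x - y) - 1)"
    by (simp add: algebra_simps flip: exp_add)
  then have "cmod (iexp x - iexp y) = cmod (iexp (x - y) - 1)"
    by (simp add: norm_mult)
  then show ?thesis using iexp_approx1[of "x - y" 0] by simp
qed

lemma distr_std_normal_scale:
  assumes c: "0 < c"
  shows "distr std_normal_distribution borel (\<lambda>x. c * x) = density lborel (\<lambda>x. ennreal (normal_density 0 c x))"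
proof -
  interpret prob_space std_normal_distribution
    using prob_space_normal_density[of 1 0] by simp
  have "distributed std_normal_distribution lborel (\<lambda>x. x) (normal_density 0 1)"
    unfolding distributed_def by (simp add: distr_id2)
  from normal_density_affine[OF this, of c 0] show ?thesis
    using c by (simp add: distributed_def cong: distr_cong)
qed

text \<open>A version of Slutsky's theorem. Characteristic functions are bounded and Lipschitz, so replacing \<open>c S\<close> by
the nearby \<open>T\<close> changes them by at most \<open>|t| \<epsilon>\<close> plus twice the probability of the exceptional event;
the rest is Levy's continuity theorem.\<close>

lemma (in prob_space) weak_conv_normal_slutsky:
  fixes S T :: "nat \<Rightarrow> 'a \<Rightarrow> real"
  assumes S: "\<And>n. S n \<in> borel_measurable M" and T: "\<And>n. T n \<in> borel_measurable M" and c: "0 < c"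
    and lim: "weak_conv_m (\<lambda>n. distr M borel (S n)) std_normal_distribution"
    and close: "\<And>\<epsilon> \<gamma>. 0 < \<epsilon> \<Longrightarrow> 0 < \<gamma> \<Longrightarrow> \<forall>\<^sub>F n in sequentially.
      \<exists>A\<in>events. prob A \<le> \<gamma> \<and> (AE \<omega> in M. \<omega> \<notin> A \<longrightarrow> \<bar>T n \<omega> - c * S n \<omega>\<bar> \<le> \<epsilon>)"
  shows "weak_conv_m (\<lambda>n. distr M borel (T n)) (density lborel (\<lambda>x. ennreal (normal_density 0 c x)))"
proof (rule levy_continuity)
  have rd: "real_distribution (distr M borel f)" if "f \<in> borel_measurable M" for f :: "'a \<Rightarrow> real"
    using that by (simp add: prob_space_distr real_distribution_def real_distribution_axioms_def)
  show "real_distribution (distr M borel (T n))" for n by (rule rd[OF T])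
  show "real_distribution (density lborel (\<lambda>x. ennreal (normal_density 0 c x)))"
    using prob_space_normal_density[OF c, of 0]
    by (simp add: real_distribution_def real_distribution_axioms_def)
  fix t :: real
  note [measurable] = S T
  have char_S: "(\<lambda>n. char (distr M borel (S n)) (t * c)) \<longlonglongrightarrow> char std_normal_distribution (t * c)"
    by (rule levy_continuity1[OF rd[OF S] real_dist_normal_dist lim])
  have char_lim: "char (density lborel (\<lambda>x. ennreal (normal_density 0 c x))) t = char std_normal_distribution (t * c)"
    unfolding distr_std_normal_scale[OF c, symmetric] char_def
    by (subst integral_distr) (auto simp: mult.assoc)
  have diff: "(\<lambda>n. char (distr M borel (T n)) t - char (distr M borel (S n)) (t * c)) \<longlonglongrightarrow> 0"
  proof (rule LIMSEQ_I)
    fix r :: real assume r: "0 < r"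
    define e where "e = r / (2 * (\<bar>t\<bar> + 1))"
    have e: "0 < e" "\<bar>t\<bar> * e < r / 2"
      using r unfolding e_def by (auto simp: field_simps intro!: divide_pos_pos add_nonneg_pos)
    have "0 < r / 4" using r by simp
    from close[OF e(1) this]
    have "\<forall>\<^sub>F n in sequentially. norm (char (distr M borel (T n)) t - char (distr M borel (S n)) (t * c)) < r"
    proof eventually_elim
      case (elim n)
      then obtain A where A[measurable]: "A \<in> events" and pA: "prob A \<le> r / 4"
        and AE: "AE \<omega> in M. \<omega> \<notin> A \<longrightarrow> \<bar>T n \<omega> - c * S n \<omega>\<bar> \<le> e" by blast
      have int: "integrable M (\<lambda>\<omega>. iexp (t * T n \<omega>))" "integrable M (\<lambda>\<omega>. iexp (t * c * S n \<omega>))"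
        by (intro integrable_const_bound[where B=1]; auto)+
      have "char (distr M borel (T n)) t - char (distr M borel (S n)) (t * c)
          = (CLINT \<omega>|M. iexp (t * T n \<omega>) - iexp (t * c * S n \<omega>))"
        unfolding char_def using int by (simp add: integral_distr)
      also have "norm \<dots> \<le> (LINT \<omega>|M. norm (iexp (t * T n \<omega>) - iexp (t * c * S n \<omega>)))"
        by (rule integral_norm_bound)
      also have "\<dots> \<le> (LINT \<omega>|M. \<bar>t\<bar> * e + 2 * indicator A \<omega>)"
      proof (rule integral_mono_AE)
        show "integrable M (\<lambda>\<omega>. norm (iexp (t * T n \<omega>) - iexp (t * c * S n \<omega>)))"
          using int by (intro integrable_norm Bochner_Integration.integrable_diff)
        show "integrable M (\<lambda>\<omega>. \<bar>t\<bar> * e + 2 * indicator A \<omega>)"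
          by (intro Bochner_Integration.integrable_add integrable_mult_right integrable_const integrable_indicator) (auto simp: emeasure_eq_measure)
        show "AE \<omega> in M. norm (iexp (t * T n \<omega>) - iexp (t * c * S n \<omega>)) \<le> \<bar>t\<bar> * e + 2 * indicator A \<omega>"
          using AE
        proof eventually_elim
          case (elim \<omega>)
          show ?case
          proof (cases "\<omega> \<in> A")
            case True
            have "norm (iexp (t * T n \<omega>) - iexp (t * c * S n \<omega>)) \<le> 1 + 1"
              using norm_triangle_ineq4[of "iexp (t * T n \<omega>)" "iexp (t * c * S n \<omega>)"]
              unfolding norm_exp_i_times by simp
            moreover have "0 \<le> \<bar>t\<bar> * e" using e(1) by simp
            ultimately show ?thesis using True by (simp only: indicator_simps)
          next
            case False
            have "norm (iexp (t * T n \<omega>) - iexp (t * c * S n \<omega>)) \<le> \<bar>t * T n \<omega> - t * c * S n \<omega>\<bar>"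
              by (rule cmod_iexp_diff_le)
            also have "\<dots> = \<bar>t\<bar> * \<bar>T n \<omega> - c * S n \<omega>\<bar>"
              by (simp add: abs_mult[symmetric] algebra_simps)
            also have "\<dots> \<le> \<bar>t\<bar> * e" using elim False by (intro mult_left_mono) auto
            finally show ?thesis using False by simp
          qed
        qed
      qed
      also have "\<dots> = \<bar>t\<bar> * e + 2 * prob A"
        by (subst Bochner_Integration.integral_add)
          (auto simp: prob_space emeasure_eq_measure intro!: integrable_mult_right integrable_indicator)
      finally show ?case using pA e(2) by linarith
    qed
    then show "\<exists>no. \<forall>n\<ge>no. norm (char (distr M borel (T n)) t - char (distr M borel (S n)) (t * c) - 0) < r"
      by (simp add: eventually_sequentially)
  qed
  show "(\<lambda>n. char (distr M borel (T n)) t) \<longlonglongrightarrow> char (density lborel (\<lambda>x. ennreal (normal_density 0 c x))) t"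
    using tendsto_add[OF diff char_S] by (simp add: char_lim)
qed

lemma (in prob_space) second_moment_sum_indep:
  fixes U :: "nat \<Rightarrow> 'a \<Rightarrow> real"
  assumes indep: "indep_vars (\<lambda>_. borel) U UNIV"
    and sq: "\<And>i. integrable M (\<lambda>\<omega>. (U i \<omega>)\<^sup>2)" and mean: "\<And>i. expectation (U i) = 0"
  shows "integrable M (\<lambda>\<omega>. (\<Sum>i<n. U i \<omega>)\<^sup>2)"
    and "expectation (\<lambda>\<omega>. (\<Sum>i<n. U i \<omega>)\<^sup>2) = (\<Sum>i<n. expectation (\<lambda>\<omega>. (U i \<omega>)\<^sup>2))"
proof -
  have meas[measurable]: "U i \<in> borel_measurable M" for i using indep by (simp add: indep_vars_def)
  have int: "integrable M (U i)" for i by (rule square_integrable_imp_integrable[OF meas sq])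
  have cross: "integrable M (\<lambda>\<omega>. U i \<omega> * U j \<omega>) \<and>
      expectation (\<lambda>\<omega>. U i \<omega> * U j \<omega>) = (if i = j then expectation (\<lambda>\<omega>. (U i \<omega>)\<^sup>2) else 0)" for i j
  proof (cases "i = j")
    case True then show ?thesis using sq[of j] by (simp add: power2_eq_square)
  next
    case False
    have ind: "indep_vars (\<lambda>_. borel) U {i, j}" using indep by (rule indep_vars_subset) auto
    show ?thesis
      using indep_vars_lebesgue_integral[OF _ ind int] indep_vars_integrable[OF _ ind int] False mean
      by simp
  qed
  have eq: "(\<lambda>\<omega>. (\<Sum>i<n. U i \<omega>)\<^sup>2) = (\<lambda>\<omega>. \<Sum>i<n. \<Sum>j<n. U i \<omega> * U j \<omega>)"
    by (simp add: power2_eq_square sum_product)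
  show "integrable M (\<lambda>\<omega>. (\<Sum>i<n. U i \<omega>)\<^sup>2)"
    unfolding eq using cross by (intro Bochner_Integration.integrable_sum) blast
  have "expectation (\<lambda>\<omega>. (\<Sum>i<n. U i \<omega>)\<^sup>2) = (\<Sum>i<n. \<Sum>j<n. expectation (\<lambda>\<omega>. U i \<omega> * U j \<omega>))"
    unfolding eq by (simp add: Bochner_Integration.integral_sum Bochner_Integration.integrable_sum cross)
  also have "\<dots> = (\<Sum>i<n. expectation (\<lambda>\<omega>. (U i \<omega>)\<^sup>2))" using cross by simp
  finally show "expectation (\<lambda>\<omega>. (\<Sum>i<n. U i \<omega>)\<^sup>2) = (\<Sum>i<n. expectation (\<lambda>\<omega>. (U i \<omega>)\<^sup>2))" .
qed

locale iid_sample = prob_space P + Q: prob_space Q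
  for P :: "'w measure" and Q :: "'v measure" +
  fixes V :: "nat \<Rightarrow> 'w \<Rightarrow> 'v"
  assumes indep_V: "indep_vars (\<lambda>_. Q) V UNIV" and distr_V: "\<And>i. distr P Q (V i) = Q"
begin

lemma V_measurable [measurable]: "V i \<in> P \<rightarrow>\<^sub>M Q"
  using indep_V by (simp add: indep_vars_def)

lemma integrable_V: "integrable Q g \<Longrightarrow> integrable P (\<lambda>\<omega>. g (V i \<omega>) :: real)"
  using integrable_distr[of "V i" P Q g] by (simp add: distr_V)

lemma integral_V:
  assumes "g \<in> borel_measurable Q"
  shows "(\<integral>\<omega>. (g (V i \<omega>) :: real) \<partial>P) = (\<integral>v. g v \<partial>Q)"
  using integral_distr[of "V i" P Q g] assms by (simp add: distr_V)

lemma AE_V: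
  assumes "AE v in Q. p v"
  shows "AE \<omega> in P. \<forall>i. p (V i \<omega>)"
  unfolding AE_all_countable
proof
  fix i
  show "AE \<omega> in P. p (V i \<omega>)"
    by (rule AE_distrD[OF V_measurable]) (unfold distr_V, rule assms)
qed

definition centered_sum :: "('v \<Rightarrow> real) \<Rightarrow> nat \<Rightarrow> 'w \<Rightarrow> real" where
  "centered_sum g n \<omega> = (\<Sum>i<n. g (V i \<omega>) - (\<integral>v. g v \<partial>Q))"

lemma centered_sum_measurable [measurable]:
  assumes "g \<in> borel_measurable Q"
  shows "centered_sum g n \<in> borel_measurable P"
  unfolding centered_sum_def
  by (intro borel_measurable_sum borel_measurable_diff measurable_compose[OF V_measurable assms]
      borel_measurable_const)

lemma centered_sum_diff:
  assumes "integrable Q g" "integrable Q h"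
  shows "centered_sum g n \<omega> - centered_sum h n \<omega> = centered_sum (\<lambda>v. g v - h v) n \<omega>"
  using assms by (simp add: centered_sum_def sum_subtractf right_diff_distrib)

lemma centered_sum_second_moment:
  assumes g[measurable]: "g \<in> borel_measurable Q" and g2: "integrable Q (\<lambda>v. (g v)\<^sup>2)"
  shows "integrable P (\<lambda>\<omega>. (centered_sum g n \<omega>)\<^sup>2)"
    and "(\<integral>\<omega>. (centered_sum g n \<omega>)\<^sup>2 \<partial>P) \<le> n * (\<integral>v. (g v)\<^sup>2 \<partial>Q)"
proof -
  let ?\<mu> = "\<integral>v. g v \<partial>Q"
  have g1: "integrable Q g" by (rule Q.square_integrable_imp_integrable[OF g g2])
  have c2: "integrable Q (\<lambda>v. (g v - ?\<mu>)\<^sup>2)"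
    using g1 g2 by (simp add: power2_diff)
  have var: "(\<integral>v. (g v - ?\<mu>)\<^sup>2 \<partial>Q) \<le> (\<integral>v. (g v)\<^sup>2 \<partial>Q)"
    using Q.variance_eq[OF g1 g2] by simp
  let ?U = "\<lambda>i \<omega>. g (V i \<omega>) - ?\<mu>"
  have ind: "indep_vars (\<lambda>_. borel) ?U UNIV"
    using indep_vars_compose2[OF indep_V, of "\<lambda>_ v. g v - ?\<mu>" "\<lambda>_. borel"] by simp
  have sq: "integrable P (\<lambda>\<omega>. (?U i \<omega>)\<^sup>2)" for i using integrable_V[OF c2] .
  have mean: "expectation (?U i) = 0" for i
    using integral_V[of "\<lambda>v. g v - ?\<mu>" i] g1 by (simp add: Q.prob_space)
  show "integrable P (\<lambda>\<omega>. (centered_sum g n \<omega>)\<^sup>2)"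
    unfolding centered_sum_def by (rule second_moment_sum_indep[OF ind sq mean])
  have "(\<integral>\<omega>. (centered_sum g n \<omega>)\<^sup>2 \<partial>P) = n * (\<integral>v. (g v - ?\<mu>)\<^sup>2 \<partial>Q)"
    unfolding centered_sum_def second_moment_sum_indep(2)[OF ind sq mean]
    using integral_V[of "\<lambda>v. (g v - ?\<mu>)\<^sup>2"] by simp
  also have "\<dots> \<le> n * (\<integral>v. (g v)\<^sup>2 \<partial>Q)" using var by (intro mult_left_mono) auto
  finally show "(\<integral>\<omega>. (centered_sum g n \<omega>)\<^sup>2 \<partial>P) \<le> n * (\<integral>v. (g v)\<^sup>2 \<partial>Q)" .
qed

end

section \<open>M-estimation with a criterion that is Lipschitz in a real parameter\<close>

text \<open>A function within \<open>e\<close> of a parabola with vertex \<open>- d / a\<close> has its minimizer near that vertex: the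
value of the parabola at the minimizer exceeds its minimum by at most \<open>2 e\<close>, and this excess is
\<open>a / 2\<close> times the squared distance to the vertex.\<close>

lemma argmin_near_quadratic_argmin:
  fixes Y :: "real \<Rightarrow> real" and a d e h K :: real
  assumes Y: "\<And>h. \<bar>h\<bar> \<le> K \<Longrightarrow> \<bar>Y h - (h * d + a / 2 * h\<^sup>2)\<bar> \<le> e"
    and h: "\<bar>h\<bar> \<le> K" "Y h \<le> Y (- d / a)" and d: "\<bar>- d / a\<bar> \<le> K" and a: "0 < a"
  shows "a / 2 * (h + d / a)\<^sup>2 \<le> 2 * e"
proof -
  have "h * d + a / 2 * h\<^sup>2 - e \<le> (- d / a) * d + a / 2 * (- d / a)\<^sup>2 + e"
    using Y[OF h(1)] Y[OF d] h(2) by linarith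
  moreover have "a / 2 * (h + d / a)\<^sup>2 = (h * d + a / 2 * h\<^sup>2) - ((- d / a) * d + a / 2 * (- d / a)\<^sup>2)"
    using a by (simp add: power2_eq_square field_simps)
  ultimately show ?thesis by linarith
qed

text \<open>The assumption \<open>m_far\<close> replaces compactness of the parameter space: beyond distance \<open>R\<close> from \<open>\<theta>0\<close> the
criterion is constant in the parameter, so that a minimizer outside the interval forces \<open>\<theta>0 + R\<close> to be
one too. The number \<open>a\<close> is the second derivative of the population criterion at \<open>\<theta>0\<close>, in the weak
sense of a quadratic expansion.\<close>

locale lipschitz_M_estimation = iid_sample P Q V
  for P :: "'w measure" and Q :: "'v measure" and V +
  fixes m :: "real \<Rightarrow> 'v \<Rightarrow> real" and psi :: "'v \<Rightarrow> real" and \<theta>0 C R a :: real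
  assumes m_measurable [measurable]: "\<And>\<theta>. m \<theta> \<in> borel_measurable Q"
    and psi_measurable [measurable]: "psi \<in> borel_measurable Q"
    and m_Lipschitz: "\<And>\<theta> \<theta>' v. v \<in> space Q \<Longrightarrow> \<bar>m \<theta> v - m \<theta>' v\<bar> \<le> C * \<bar>\<theta> - \<theta>'\<bar>"
    and m_deriv: "AE v in Q. ((\<lambda>\<theta>. m \<theta> v) has_real_derivative psi v) (at \<theta>0)"
    and m_far: "AE v in Q. \<forall>\<theta>. R \<le> \<bar>\<theta> - \<theta>0\<bar> \<longrightarrow> m \<theta> v = m (\<theta>0 + R) v"
    and R_pos: "0 < R" and a_pos: "0 < a"
    and curvature: "((\<lambda>t. (\<integral>v. m (\<theta>0 + t) v - m \<theta>0 v \<partial>Q) / t\<^sup>2) \<longlongrightarrow> a / 2) (at 0)"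
    and separation: "\<And>\<delta>. 0 < \<delta> \<Longrightarrow> \<exists>\<eta>>0. \<forall>\<theta>. \<delta> \<le> \<bar>\<theta> - \<theta>0\<bar> \<longrightarrow> \<eta> \<le> (\<integral>v. m \<theta> v - m \<theta>0 v \<partial>Q)"
    and psi_nondegenerate: "0 < (\<integral>v. (psi v)\<^sup>2 \<partial>Q)"
begin

definition excess :: "real \<Rightarrow> real" where
  "excess \<theta> = (\<integral>v. m \<theta> v - m \<theta>0 v \<partial>Q)"

definition incr :: "nat \<Rightarrow> real \<Rightarrow> 'v \<Rightarrow> real" where
  "incr n h v = m (\<theta>0 + h / sqrt n) v - m \<theta>0 v"

definition score :: "nat \<Rightarrow> 'w \<Rightarrow> real" where
  "score n \<omega> = (\<Sum>i<n. psi (V i \<omega>)) / sqrt n"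

lemma C_nonneg: "0 \<le> C"
proof -
  obtain v where "v \<in> space Q" using Q.not_empty by blast
  from m_Lipschitz[OF this, of 1 0] show ?thesis by simp
qed

lemma square_integrable_bounded:
  fixes B :: real
  assumes g[measurable]: "g \<in> borel_measurable Q" and b: "AE v in Q. \<bar>g v\<bar> \<le> B"
  shows "integrable Q g" "integrable Q (\<lambda>v. (g v)\<^sup>2)" "(\<integral>v. (g v)\<^sup>2 \<partial>Q) \<le> B\<^sup>2"
proof -
  show 1: "integrable Q g" using b by (intro Q.integrable_const_bound[where B=B]) auto
  have b2: "AE v in Q. (g v)\<^sup>2 \<le> B\<^sup>2"
    using b by eventually_elim (metis abs_ge_zero power2_abs power_mono)
  then show 2: "integrable Q (\<lambda>v. (g v)\<^sup>2)" by (intro Q.integrable_const_bound[where B="B\<^sup>2"]) auto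
  have "(\<integral>v. (g v)\<^sup>2 \<partial>Q) \<le> (\<integral>v. B\<^sup>2 \<partial>Q)" using b2 2 by (intro integral_mono_AE) auto
  then show "(\<integral>v. (g v)\<^sup>2 \<partial>Q) \<le> B\<^sup>2" by (simp add: Q.prob_space)
qed

lemma incr_measurable [measurable]: "incr n h \<in> borel_measurable Q"
  unfolding incr_def by measurable

lemma incr_0 [simp]: "incr n 0 v = 0"
  by (simp add: incr_def)

lemma incr_Lipschitz:
  assumes "v \<in> space Q"
  shows "\<bar>incr n h v - incr n h' v\<bar> \<le> C / sqrt n * \<bar>h - h'\<bar>"
proof -
  have "\<bar>incr n h v - incr n h' v\<bar> = \<bar>m (\<theta>0 + h / sqrt n) v - m (\<theta>0 + h' / sqrt n) v\<bar>"
    by (simp add: incr_def)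
  also have "\<dots> \<le> C * \<bar>(\<theta>0 + h / sqrt n) - (\<theta>0 + h' / sqrt n)\<bar>" by (rule m_Lipschitz[OF assms])
  also have "\<bar>(\<theta>0 + h / sqrt n) - (\<theta>0 + h' / sqrt n)\<bar> = \<bar>h - h'\<bar> / sqrt n"
    by (simp add: diff_divide_distrib[symmetric])
  finally show ?thesis by simp
qed

lemma incr_integrable: "integrable Q (incr n h)"
  using incr_Lipschitz[of _ n h 0] by (intro square_integrable_bounded(1)[where B="C / sqrt n * \<bar>h\<bar>"]) auto

lemma integral_incr: "(\<integral>v. incr n h v \<partial>Q) = excess (\<theta>0 + h / sqrt n)"
  by (simp add: incr_def excess_def)

lemma excess_Lipschitz: "\<bar>excess \<theta> - excess \<theta>'\<bar> \<le> C * \<bar>\<theta> - \<theta>'\<bar>"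
proof -
  have int: "integrable Q (\<lambda>v. m \<theta> v - m \<theta>' v)" for \<theta> \<theta>'
    using m_Lipschitz[of _ \<theta> \<theta>'] by (intro square_integrable_bounded(1)[where B="C * \<bar>\<theta> - \<theta>'\<bar>"]) auto
  have "excess \<theta> - excess \<theta>' = (\<integral>v. m \<theta> v - m \<theta>' v \<partial>Q)"
    unfolding excess_def using int by (subst Bochner_Integration.integral_diff[symmetric]) auto
  also have "\<bar>\<dots>\<bar> \<le> (\<integral>v. \<bar>m \<theta> v - m \<theta>' v\<bar> \<partial>Q)" by (rule integral_abs_bound)
  also have "\<dots> \<le> (\<integral>v. C * \<bar>\<theta> - \<theta>'\<bar> \<partial>Q)"
    using int m_Lipschitz by (intro integral_mono) auto
  finally show ?thesis by (simp add: Q.prob_space)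
qed

lemma continuous_incr: "v \<in> space Q \<Longrightarrow> continuous_on UNIV (\<lambda>h. incr n h v)"
  using incr_Lipschitz[of v n] C_nonneg
  by (intro lipschitz_on_continuous_on[where L="C / sqrt n"] lipschitz_onI) (auto simp: dist_real_def)

lemma continuous_excess: "continuous_on UNIV excess"
  using excess_Lipschitz C_nonneg
  by (intro lipschitz_on_continuous_on[where L=C] lipschitz_onI) (auto simp: dist_real_def)

lemma continuous_centered_sum_incr:
  assumes "\<omega> \<in> space P"
  shows "continuous_on UNIV (\<lambda>h. centered_sum (incr n h) n \<omega>)"
proof -
  have "V i \<omega> \<in> space Q" for i by (rule measurable_space[OF V_measurable assms])
  then have "continuous_on UNIV (\<lambda>h. incr n h (V i \<omega>))" for i by (rule continuous_incr)
  moreover have "continuous_on UNIV (\<lambda>h. excess (\<theta>0 + h / sqrt n))"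
  proof (rule continuous_on_compose2[OF continuous_excess])
    have "continuous_on UNIV (\<lambda>h. \<theta>0 + h * (1 / sqrt n))"
      by (intro continuous_on_add continuous_on_mult_right continuous_on_const continuous_on_id)
    then show "continuous_on UNIV (\<lambda>h. \<theta>0 + h / sqrt n)" by simp
  qed simp
  ultimately show ?thesis
    unfolding centered_sum_def integral_incr by (intro continuous_on_sum continuous_on_diff)
qed

lemma centered_sum_incr_second_moment:
  assumes n: "1 \<le> n"
  shows "integrable P (\<lambda>\<omega>. (centered_sum (incr n h) n \<omega> - centered_sum (incr n h') n \<omega>)\<^sup>2)"
    and "(\<integral>\<omega>. (centered_sum (incr n h) n \<omega> - centered_sum (incr n h') n \<omega>)\<^sup>2 \<partial>P) \<le> C\<^sup>2 * (h - h')\<^sup>2"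
proof -
  let ?g = "\<lambda>v. incr n h v - incr n h' v"
  note sb = square_integrable_bounded[of ?g "C / sqrt n * \<bar>h - h'\<bar>"]
  have b: "AE v in Q. \<bar>?g v\<bar> \<le> C / sqrt n * \<bar>h - h'\<bar>" using incr_Lipschitz by auto
  have g2: "integrable Q (\<lambda>v. (?g v)\<^sup>2)" using sb(2) b by simp
  have eq: "centered_sum (incr n h) n \<omega> - centered_sum (incr n h') n \<omega> = centered_sum ?g n \<omega>" for \<omega>
    by (rule centered_sum_diff[OF incr_integrable incr_integrable])
  show "integrable P (\<lambda>\<omega>. (centered_sum (incr n h) n \<omega> - centered_sum (incr n h') n \<omega>)\<^sup>2)"
    unfolding eq by (rule centered_sum_second_moment(1)) (use g2 in auto)
  have "(\<integral>\<omega>. (centered_sum ?g n \<omega>)\<^sup>2 \<partial>P) \<le> n * (\<integral>v. (?g v)\<^sup>2 \<partial>Q)"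
    by (rule centered_sum_second_moment(2)) (use g2 in auto)
  also have "\<dots> \<le> n * (C / sqrt n * \<bar>h - h'\<bar>)\<^sup>2"
    using sb(3) b by (intro mult_left_mono) auto
  also have "\<dots> = C\<^sup>2 * (h - h')\<^sup>2"
    using n by (simp add: power_mult_distrib power_divide)
  finally show "(\<integral>\<omega>. (centered_sum (incr n h) n \<omega> - centered_sum (incr n h') n \<omega>)\<^sup>2 \<partial>P) \<le> C\<^sup>2 * (h - h')\<^sup>2"
    unfolding eq .
qed

text \<open>The sum of the chaining bounds of all levels, per unit length; the factor 2 accounts for the two half-lines.\<close>

definition chaining_constant :: real where
  "chaining_constant = 2 * C * (\<Sum>k. sqrt (1/2) ^ k)"

lemma summable_sqrt_half: "summable (\<lambda>k. sqrt (1/2) ^ k)"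
proof -
  have "sqrt (1/2) < sqrt 1" by (intro real_sqrt_less_mono) simp
  then show ?thesis by (intro summable_geometric) simp
qed

lemma sqrt_half_power: "(sqrt (1/2) ^ k)\<^sup>2 = 1 / 2 ^ k"
proof -
  have "(sqrt (1/2) ^ k)\<^sup>2 = ((sqrt (1/2))\<^sup>2) ^ k" by (simp only: power_mult[symmetric] mult.commute)
  then show ?thesis by (simp add: power_one_over)
qed

lemma chaining_constant_nonneg: "0 \<le> chaining_constant"
  unfolding chaining_constant_def using C_nonneg summable_sqrt_half by (intro mult_nonneg_nonneg suminf_nonneg) auto

text \<open>The increments of the centred local process over steps of length \<open>L / 2 ^ k\<close> have mean square at most
\<open>C\<^sup>2 L\<^sup>2 / 4 ^ k\<close>, so the \<open>2 ^ k\<close> steps of level \<open>k\<close> contribute \<open>C L (1/2) ^ (k/2)\<close> to the chaining bound.\<close>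

lemma local_maximal_inequality:
  assumes n: "1 \<le> n" and L: "0 < L" and e: "0 < e"
  shows "\<exists>A\<in>events. prob A \<le> chaining_constant * L / e \<and>
    (\<forall>\<omega>\<in>space P - A. \<forall>h. \<bar>h\<bar> \<le> L \<longrightarrow> \<bar>centered_sum (incr n h) n \<omega>\<bar> < e)"
proof -
  let ?v = "\<lambda>k. C * L * sqrt (1/2) ^ k"
  have "\<exists>A\<in>events. prob A \<le> 2 * suminf ?v / e \<and>
    (\<forall>\<omega>\<in>space P - A. \<forall>h. \<bar>h\<bar> \<le> L \<longrightarrow> \<bar>centered_sum (incr n h) n \<omega>\<bar> < e)"
  proof (rule two_sided_maximal_inequality)
    fix k :: nat and s assume s: "s \<in> {L, - L}"
    have s2: "s\<^sup>2 = L\<^sup>2" using s by auto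
    have step: "s * (real i + 1) / 2 ^ k - s * real i / 2 ^ k = s / 2 ^ k" for i
      unfolding diff_divide_distrib[symmetric] by (simp add: ring_distribs)
    have sm: "expectation (\<lambda>\<omega>. (centered_sum (incr n (s * (real i + 1) / 2 ^ k)) n \<omega>
        - centered_sum (incr n (s * real i / 2 ^ k)) n \<omega>)\<^sup>2) \<le> C\<^sup>2 * (s / 2 ^ k)\<^sup>2" for i
      using centered_sum_incr_second_moment(2)[OF n, of "s * (real i + 1) / 2 ^ k" "s * real i / 2 ^ k"]
      unfolding step .
    have "(\<Sum>i<2 ^ k. expectation (\<lambda>\<omega>. (centered_sum (incr n (s * (real i + 1) / 2 ^ k)) n \<omega>
        - centered_sum (incr n (s * real i / 2 ^ k)) n \<omega>)\<^sup>2)) \<le> (\<Sum>i<(2::nat) ^ k. C\<^sup>2 * (s / 2 ^ k)\<^sup>2)"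
      by (intro sum_mono sm)
    also have "\<dots> = (?v k)\<^sup>2"
      unfolding power_mult_distrib sqrt_half_power power_divide s2 by (simp add: power2_eq_square)
    finally show "(\<Sum>i<2 ^ k. expectation (\<lambda>\<omega>. (centered_sum (incr n (s * (real i + 1) / 2 ^ k)) n \<omega>
        - centered_sum (incr n (s * real i / 2 ^ k)) n \<omega>)\<^sup>2)) \<le> (?v k)\<^sup>2" .
  next
    show "summable ?v" by (intro summable_mult summable_sqrt_half)
    show "0 \<le> ?v k" for k using C_nonneg L by simp
    show "centered_sum (incr n 0) n \<omega> = 0" for \<omega> by (simp add: centered_sum_def)
  qed (use L e n in \<open>auto intro: continuous_centered_sum_incr centered_sum_incr_second_moment\<close>)
  moreover have "2 * suminf ?v / e = chaining_constant * L / e"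
    using suminf_mult[OF summable_sqrt_half, of "C * L"] by (simp add: chaining_constant_def)
  ultimately show ?thesis by simp
qed

text \<open>Near \<open>\<theta>0\<close> the growth comes from the curvature; at a positive distance the excess is bounded below by
separation, and the distance is bounded above by \<open>R\<close>.\<close>

lemma excess_quadratic_growth:
  "\<exists>c>0. \<forall>\<theta>. \<bar>\<theta> - \<theta>0\<bar> \<le> R \<longrightarrow> c * (\<theta> - \<theta>0)\<^sup>2 \<le> excess \<theta>"
proof -
  have "\<forall>\<^sub>F t in at 0. a / 4 < excess (\<theta>0 + t) / t\<^sup>2"
    unfolding excess_def using a_pos by (intro order_tendstoD(1)[OF curvature]) simp
  then obtain d where d: "0 < d" "\<And>t. t \<noteq> 0 \<Longrightarrow> \<bar>t\<bar> < d \<Longrightarrow> a / 4 < excess (\<theta>0 + t) / t\<^sup>2"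
    by (auto simp: eventually_at dist_real_def)
  obtain \<eta> where eta: "0 < \<eta>" "\<And>\<theta>. d \<le> \<bar>\<theta> - \<theta>0\<bar> \<Longrightarrow> \<eta> \<le> excess \<theta>"
    using separation[OF d(1)] by (auto simp: excess_def)
  define c where "c = min (a / 4) (\<eta> / R\<^sup>2)"
  have c: "0 < c" "c \<le> a / 4" "c \<le> \<eta> / R\<^sup>2"
    unfolding c_def using a_pos eta(1) R_pos by (simp_all only: min_less_iff_conj min.cobounded1 min.cobounded2) simp_all
  have "c * (\<theta> - \<theta>0)\<^sup>2 \<le> excess \<theta>" if R: "\<bar>\<theta> - \<theta>0\<bar> \<le> R" for \<theta>
  proof (cases "\<theta> = \<theta>0 \<or> d \<le> \<bar>\<theta> - \<theta>0\<bar>")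
    case False
    then have "a / 4 < excess \<theta> / (\<theta> - \<theta>0)\<^sup>2" using d(2)[of "\<theta> - \<theta>0"] by simp
    then have "a / 4 * (\<theta> - \<theta>0)\<^sup>2 \<le> excess \<theta>" using False by (simp add: field_simps)
    then show ?thesis using mult_right_mono[OF c(2), of "(\<theta> - \<theta>0)\<^sup>2"] by simp
  next
    case True
    show ?thesis
    proof (cases "\<theta> = \<theta>0")
      case False
      then have "\<eta> \<le> excess \<theta>" using True eta(2) by simp
      moreover have "c * (\<theta> - \<theta>0)\<^sup>2 \<le> \<eta> / R\<^sup>2 * R\<^sup>2"
        using c R by (intro mult_mono) (auto simp: abs_le_square_iff[symmetric])
      ultimately show ?thesis using R_pos by simp
    qed (simp add: excess_def)
  qed
  then show ?thesis using c(1) by blast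
qed

lemma sum_incr: "(\<Sum>i<n. incr n h (V i \<omega>)) = centered_sum (incr n h) n \<omega> + n * excess (\<theta>0 + h / sqrt n)"
  by (simp add: centered_sum_def sum_subtractf integral_incr)

text \<open>Peeling. On the shell of all \<open>h\<close> with \<open>|h|\<close> between \<open>K 2 ^ j\<close> and \<open>K 2 ^ Suc j\<close>, up to \<open>R \<surd>n\<close>, the population
part of the local criterion is at least \<open>c K\<^sup>2 4 ^ j\<close>, while the centred part exceeds this only with
probability of order \<open>2 ^ j / (K 4 ^ j)\<close>. Summing over the shells leaves a bound of order \<open>1 / K\<close>, uniform
in \<open>n\<close>. A parameter at which the local criterion is positive cannot be a minimizer, so this bounds the
rescaled estimator in probability.\<close>

lemma root_n_rate:
  "\<exists>k\<ge>0. \<forall>n\<ge>1. \<forall>K>0. \<exists>A\<in>events. prob A \<le> k / K \<and>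
     (\<forall>\<omega>\<in>space P - A. \<forall>h. K \<le> \<bar>h\<bar> \<and> \<bar>h\<bar> \<le> R * sqrt n \<longrightarrow> 0 < (\<Sum>i<n. incr n h (V i \<omega>)))"
proof -
  obtain c where c: "0 < c" "\<And>\<theta>. \<bar>\<theta> - \<theta>0\<bar> \<le> R \<Longrightarrow> c * (\<theta> - \<theta>0)\<^sup>2 \<le> excess \<theta>"
    using excess_quadratic_growth by blast
  have "\<exists>A\<in>events. prob A \<le> (4 * chaining_constant / c) / K \<and>
     (\<forall>\<omega>\<in>space P - A. \<forall>h. K \<le> \<bar>h\<bar> \<and> \<bar>h\<bar> \<le> R * sqrt n \<longrightarrow> 0 < (\<Sum>i<n. incr n h (V i \<omega>)))"
    if n: "1 \<le> n" and K: "0 < K" for n K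
  proof -
    have "\<forall>j::nat. \<exists>A\<in>events. prob A \<le> chaining_constant * (K * 2 ^ Suc j) / (c * K\<^sup>2 * 4 ^ j) \<and>
      (\<forall>\<omega>\<in>space P - A. \<forall>h. \<bar>h\<bar> \<le> K * 2 ^ Suc j \<longrightarrow> \<bar>centered_sum (incr n h) n \<omega>\<bar> < c * K\<^sup>2 * 4 ^ j)"
      using K c(1) by (intro allI local_maximal_inequality[OF n]) auto
    then obtain A where A: "\<And>j. A j \<in> events"
      and pA: "\<And>j. prob (A j) \<le> chaining_constant * (K * 2 ^ Suc j) / (c * K\<^sup>2 * 4 ^ j)"
      and W: "\<And>j \<omega> h. \<omega> \<in> space P - A j \<Longrightarrow> \<bar>h\<bar> \<le> K * 2 ^ Suc j \<Longrightarrow>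
        \<bar>centered_sum (incr n h) n \<omega>\<bar> < c * K\<^sup>2 * 4 ^ j"
      by metis
    have pA': "prob (A j) \<le> 2 * chaining_constant / (c * K) * (1/2) ^ j" for j
    proof -
      have "(4::real) ^ j = 2 ^ j * 2 ^ j" by (simp flip: power_mult_distrib)
      then show ?thesis using pA[of j] K c(1) by (simp add: power_one_over power2_eq_square field_simps)
    qed
    have sg: "(\<lambda>j. 2 * chaining_constant / (c * K) * (1/2) ^ j) sums (2 * chaining_constant / (c * K) * 2)"
    proof (rule sums_mult)
      show "(\<lambda>j. (1/2) ^ j) sums (2::real)" using geometric_sums[of "1/2::real"] by simp
    qed
    have sA: "summable (\<lambda>j. prob (A j))"
      by (rule summable_comparison_test'[OF sums_summable[OF sg], of 0]) (use pA' in simp)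
    have "prob (\<Union>j. A j) \<le> (\<Sum>j. prob (A j))"
      using A sA by (intro finite_measure_subadditive_countably) auto
    also have "\<dots> \<le> 2 * chaining_constant / (c * K) * 2"
      using suminf_le[OF pA' sA sums_summable[OF sg]] sums_unique[OF sg] by simp
    finally have p: "prob (\<Union>j. A j) \<le> (4 * chaining_constant / c) / K" by simp
    have "0 < (\<Sum>i<n. incr n h (V i \<omega>))"
      if \<omega>: "\<omega> \<in> space P - (\<Union>j. A j)" and h: "K \<le> \<bar>h\<bar>" "\<bar>h\<bar> \<le> R * sqrt n" for \<omega> h
    proof -
      have "\<exists>j. \<bar>h\<bar> < K * 2 ^ Suc j"
      proof -
        obtain j where "\<bar>h\<bar> / K < 2 ^ j" using real_arch_pow[of 2 "\<bar>h\<bar> / K"] by auto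
        then have "\<bar>h\<bar> < K * 2 ^ j" using K by (simp add: field_simps)
        also have "\<dots> \<le> K * 2 ^ Suc j" using K by simp
        finally show ?thesis by blast
      qed
      \<comment> \<open>The shell that contains \<open>h\<close>.\<close>
      define j where "j = (LEAST j. \<bar>h\<bar> < K * 2 ^ Suc j)"
      have j1: "\<bar>h\<bar> < K * 2 ^ Suc j" unfolding j_def using \<open>\<exists>j. _ j\<close> by (rule LeastI_ex)
      have j2: "K * 2 ^ j \<le> \<bar>h\<bar>"
      proof (cases j)
        case (Suc i)
        then have "\<not> \<bar>h\<bar> < K * 2 ^ Suc i" using not_less_Least[of i "\<lambda>j. \<bar>h\<bar> < K * 2 ^ Suc j"] by (simp add: j_def)
        then show ?thesis using Suc by simp
      qed (use h in simp)
      have "(K * 2 ^ j)\<^sup>2 \<le> h\<^sup>2" using j2 K by (simp add: abs_le_square_iff[symmetric])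
      moreover have "(K * 2 ^ j)\<^sup>2 = K\<^sup>2 * 4 ^ j" by (simp add: power_mult_distrib power2_eq_square flip: power_mult_distrib[of 2 2])
      ultimately have "c * (K\<^sup>2 * 4 ^ j) \<le> c * h\<^sup>2" using c(1) by simp
      also have "c * h\<^sup>2 = n * (c * (h / sqrt n)\<^sup>2)" using n by (simp add: power_divide)
      also have "\<dots> \<le> n * excess (\<theta>0 + h / sqrt n)"
        using c(2)[of "\<theta>0 + h / sqrt n"] h(2) n by (intro mult_left_mono) (auto simp: field_simps)
      finally have "c * K\<^sup>2 * 4 ^ j \<le> n * excess (\<theta>0 + h / sqrt n)" by simp
      moreover have "\<bar>centered_sum (incr n h) n \<omega>\<bar> < c * K\<^sup>2 * 4 ^ j"
        using W[of \<omega> j h] \<omega> j1 by auto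
      ultimately show ?thesis unfolding sum_incr by linarith
    qed
    then show ?thesis using p A by (intro bexI[of _ "\<Union>j. A j"]) auto
  qed
  moreover have "0 \<le> 4 * chaining_constant / c" using c(1) chaining_constant_nonneg by simp
  ultimately show ?thesis by blast
qed

lemma psi_bound: "AE v in Q. \<bar>psi v\<bar> \<le> C"
  using m_deriv AE_space
proof eventually_elim
  case (elim v)
  have "((\<lambda>\<theta>. (m \<theta> v - m \<theta>0 v) / (\<theta> - \<theta>0)) \<longlongrightarrow> psi v) (at \<theta>0)"
    using elim(1) by (simp add: has_field_derivative_iff)
  then have "((\<lambda>\<theta>. \<bar>(m \<theta> v - m \<theta>0 v) / (\<theta> - \<theta>0)\<bar>) \<longlongrightarrow> \<bar>psi v\<bar>) (at \<theta>0)"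
    by (rule tendsto_rabs)
  moreover have "\<bar>(m \<theta> v - m \<theta>0 v) / (\<theta> - \<theta>0)\<bar> \<le> C" for \<theta>
    using m_Lipschitz[OF elim(2), of \<theta> \<theta>0] C_nonneg
    by (cases "\<theta> = \<theta>0") (auto simp: abs_divide divide_le_eq)
  ultimately show ?case
    by (intro tendsto_upperbound[where F="at \<theta>0"]) auto
qed

lemmas psi_integrable = square_integrable_bounded(1)[OF psi_measurable psi_bound]
lemmas psi_square_integrable = square_integrable_bounded(2)[OF psi_measurable psi_bound]

lemma difference_quotient_tendsto:
  assumes "((\<lambda>\<theta>. m \<theta> v) has_real_derivative psi v) (at \<theta>0)" and "t \<longlonglongrightarrow> 0" and "\<forall>\<^sub>F n in sequentially. t n \<noteq> 0"
  shows "(\<lambda>n. (m (\<theta>0 + t n) v - m \<theta>0 v) / t n) \<longlonglongrightarrow> psi v"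
proof -
  have "((\<lambda>t. (m (\<theta>0 + t) v - m \<theta>0 v) / t) \<longlongrightarrow> psi v) (at 0)"
    using assms(1) by (simp add: DERIV_def)
  moreover have "filterlim t (at 0) sequentially"
    using assms(2,3) by (simp add: filterlim_at)
  ultimately show ?thesis by (rule filterlim_compose)
qed

text \<open>The mean of \<open>psi\<close> is the derivative of the population criterion at \<open>\<theta>0\<close>, and this vanishes because
the excess is of second order there.\<close>

lemma psi_mean_zero: "(\<integral>v. psi v \<partial>Q) = 0"
proof -
  define t where "t n = inverse (real (Suc n))" for n
  have t: "t \<longlonglongrightarrow> 0" "\<And>n. 0 < t n" unfolding t_def using LIMSEQ_inverse_real_of_nat by auto
  have "(\<lambda>n. \<integral>v. (m (\<theta>0 + t n) v - m \<theta>0 v) / t n \<partial>Q) \<longlonglongrightarrow> (\<integral>v. psi v \<partial>Q)"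
  proof (rule integral_dominated_convergence[where w="\<lambda>_. C"])
    show "AE v in Q. (\<lambda>n. (m (\<theta>0 + t n) v - m \<theta>0 v) / t n) \<longlonglongrightarrow> psi v"
      using m_deriv by eventually_elim (rule difference_quotient_tendsto, use t in \<open>auto simp: less_imp_neq[symmetric]\<close>)
    show "AE v in Q. norm ((m (\<theta>0 + t n) v - m \<theta>0 v) / t n) \<le> C" for n
    proof (rule AE_I2)
      fix v assume "v \<in> space Q"
      from m_Lipschitz[OF this, of "\<theta>0 + t n" \<theta>0] t(2)[of n]
      show "norm ((m (\<theta>0 + t n) v - m \<theta>0 v) / t n) \<le> C" by (simp add: abs_divide divide_le_eq)
    qed
  qed auto
  moreover have "(\<integral>v. (m (\<theta>0 + t n) v - m \<theta>0 v) / t n \<partial>Q) = t n * (excess (\<theta>0 + t n) / (t n)\<^sup>2)" for n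
    using t(2)[of n] by (simp add: excess_def power2_eq_square)
  moreover have "(\<lambda>n. t n * (excess (\<theta>0 + t n) / (t n)\<^sup>2)) \<longlonglongrightarrow> 0 * (a / 2)"
  proof (intro tendsto_mult t(1))
    have "filterlim t (at 0) sequentially"
      using t by (simp add: filterlim_at less_imp_neq[symmetric])
    from filterlim_compose[OF curvature this]
    show "(\<lambda>n. excess (\<theta>0 + t n) / (t n)\<^sup>2) \<longlonglongrightarrow> a / 2" by (simp add: excess_def)
  qed
  ultimately show ?thesis using LIMSEQ_unique by fastforce
qed

lemma score_measurable [measurable]: "score n \<in> borel_measurable P"
  unfolding score_def using measurable_compose[OF V_measurable psi_measurable] by simp

lemma score_eq: "score n \<omega> = centered_sum psi n \<omega> / sqrt n"
  by (simp add: score_def centered_sum_def psi_mean_zero)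

lemma score_second_moment:
  "integrable P (\<lambda>\<omega>. (score n \<omega>)\<^sup>2)" "(\<integral>\<omega>. (score n \<omega>)\<^sup>2 \<partial>P) \<le> (\<integral>v. (psi v)\<^sup>2 \<partial>Q)"
proof -
  note * = centered_sum_second_moment[OF psi_measurable psi_square_integrable]
  show "integrable P (\<lambda>\<omega>. (score n \<omega>)\<^sup>2)"
    unfolding score_eq power_divide using *(1) by simp
  have "(\<integral>\<omega>. (score n \<omega>)\<^sup>2 \<partial>P) = (\<integral>\<omega>. (centered_sum psi n \<omega>)\<^sup>2 \<partial>P) / n"
    unfolding score_eq power_divide by simp
  also have "\<dots> \<le> (\<integral>v. (psi v)\<^sup>2 \<partial>Q)"
    using *(2)[of n] psi_nondegenerate by (cases "n = 0") (auto simp: divide_le_eq mult.commute)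
  finally show "(\<integral>\<omega>. (score n \<omega>)\<^sup>2 \<partial>P) \<le> (\<integral>v. (psi v)\<^sup>2 \<partial>Q)" .
qed

definition lin_err :: "nat \<Rightarrow> real \<Rightarrow> real \<Rightarrow> real" where
  "lin_err n h h' = (\<integral>v. (sqrt n * (incr n h v - incr n h' v) - (h - h') * psi v)\<^sup>2 \<partial>Q)"

lemma lin_err_integrand_bound:
  "AE v in Q. \<bar>sqrt n * (incr n h v - incr n h' v) - (h - h') * psi v\<bar> \<le> 2 * C * \<bar>h - h'\<bar>"
  using psi_bound AE_space
proof eventually_elim
  case (elim v)
  have "sqrt n * \<bar>incr n h v - incr n h' v\<bar> \<le> sqrt n * (C / sqrt n * \<bar>h - h'\<bar>)"
    by (intro mult_left_mono incr_Lipschitz elim) auto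
  also have "\<dots> \<le> C * \<bar>h - h'\<bar>" using C_nonneg by (cases "n = 0") auto
  finally have 1: "\<bar>sqrt n * (incr n h v - incr n h' v)\<bar> \<le> C * \<bar>h - h'\<bar>" by (simp add: abs_mult)
  have 2: "\<bar>(h - h') * psi v\<bar> \<le> C * \<bar>h - h'\<bar>"
    using mult_right_mono[OF elim(1), of "\<bar>h - h'\<bar>"] by (simp add: abs_mult mult.commute)
  show ?case using 1 2 by linarith
qed

lemma lin_err_bounds: "0 \<le> lin_err n h h'" "lin_err n h h' \<le> (2 * C * \<bar>h - h'\<bar>)\<^sup>2"
  unfolding lin_err_def by (simp, intro square_integrable_bounded(3) lin_err_integrand_bound, simp)

text \<open>For fixed \<open>h\<close> and \<open>h'\<close> the integrand tends to 0 by differentiability at \<open>\<theta>0\<close>, and the Lipschitz bound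
dominates it. Uniformity in \<open>h\<close> is supplied by chaining.\<close>

lemma lin_err_tendsto: "(\<lambda>n. lin_err n h h') \<longlonglongrightarrow> 0"
proof -
  have conv: "(\<lambda>n. sqrt n * incr n h v) \<longlonglongrightarrow> h * psi v"
    if "((\<lambda>\<theta>. m \<theta> v) has_real_derivative psi v) (at \<theta>0)" for h v
  proof (cases "h = 0")
    case False
    have "(\<lambda>n. h / sqrt (real n)) \<longlonglongrightarrow> 0"
      by (intro tendsto_divide_0[OF tendsto_const] filterlim_at_top_imp_at_infinity
          filterlim_compose[OF sqrt_at_top filterlim_real_sequentially])
    moreover have nz: "\<forall>\<^sub>F n in sequentially. h / sqrt (real n) \<noteq> 0"
      using eventually_gt_at_top[of 0] by eventually_elim (use False in simp)
    ultimately have "(\<lambda>n. h * ((m (\<theta>0 + h / sqrt n) v - m \<theta>0 v) / (h / sqrt n))) \<longlonglongrightarrow> h * psi v"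
      by (intro tendsto_mult tendsto_const difference_quotient_tendsto[OF that])
    then show ?thesis
      by (rule Lim_transform_eventually)
        (use eventually_gt_at_top[of 0] False in \<open>auto elim!: eventually_mono simp: incr_def\<close>)
  qed simp
  have "(\<lambda>n. lin_err n h h') \<longlonglongrightarrow> (\<integral>v. 0 \<partial>Q)"
    unfolding lin_err_def
  proof (rule integral_dominated_convergence[where w="\<lambda>_. (2 * C * \<bar>h - h'\<bar>)\<^sup>2"])
    show "AE v in Q. (\<lambda>n. (sqrt n * (incr n h v - incr n h' v) - (h - h') * psi v)\<^sup>2) \<longlonglongrightarrow> 0"
      using m_deriv
    proof eventually_elim
      case (elim v)
      have "(\<lambda>n. (sqrt n * incr n h v - sqrt n * incr n h' v - (h - h') * psi v)\<^sup>2)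
          \<longlonglongrightarrow> (h * psi v - h' * psi v - (h - h') * psi v)\<^sup>2"
        by (intro tendsto_intros conv elim)
      then show ?case by (simp add: algebra_simps)
    qed
    show "AE v in Q. norm ((sqrt n * (incr n h v - incr n h' v) - (h - h') * psi v)\<^sup>2) \<le> (2 * C * \<bar>h - h'\<bar>)\<^sup>2" for n
      using lin_err_integrand_bound[of n h h']
      by eventually_elim (metis abs_ge_zero norm_power power2_abs power_mono real_norm_def)
  qed auto
  then show ?thesis by simp
qed

definition remainder :: "nat \<Rightarrow> real \<Rightarrow> 'w \<Rightarrow> real" where
  "remainder n h \<omega> = centered_sum (incr n h) n \<omega> - h * score n \<omega>"

lemma remainder_measurable [measurable]: "remainder n h \<in> borel_measurable P"
  unfolding remainder_def by measurable

lemma remainder_second_moment: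
  assumes n: "1 \<le> n"
  shows "integrable P (\<lambda>\<omega>. (remainder n h \<omega> - remainder n h' \<omega>)\<^sup>2)"
    and "(\<integral>\<omega>. (remainder n h \<omega> - remainder n h' \<omega>)\<^sup>2 \<partial>P) \<le> lin_err n h h'"
proof -
  let ?g = "\<lambda>v. incr n h v - incr n h' v - (h - h') / sqrt n * psi v"
  have scaled: "n * (?g v)\<^sup>2 = (sqrt n * (incr n h v - incr n h' v) - (h - h') * psi v)\<^sup>2" for v
  proof -
    have "sqrt n * ?g v = sqrt n * (incr n h v - incr n h' v) - (h - h') * psi v"
      using n by (simp add: right_diff_distrib)
    then show ?thesis by (metis of_nat_0_le_iff power_mult_distrib real_sqrt_pow2)
  qed
  have lin2: "integrable Q (\<lambda>v. (sqrt n * (incr n h v - incr n h' v) - (h - h') * psi v)\<^sup>2)"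
    by (intro square_integrable_bounded(2)[OF _ lin_err_integrand_bound]) simp
  then have g2: "integrable Q (\<lambda>v. (?g v)\<^sup>2)"
    unfolding scaled[symmetric] using n by simp
  have eq: "remainder n h \<omega> - remainder n h' \<omega> = centered_sum ?g n \<omega>" for \<omega>
  proof -
    have "centered_sum ?g n \<omega> = centered_sum (\<lambda>v. incr n h v - incr n h' v) n \<omega>
        - centered_sum (\<lambda>v. (h - h') / sqrt n * psi v) n \<omega>"
      by (intro centered_sum_diff[symmetric]) (use incr_integrable psi_integrable in auto)
    also have "centered_sum (\<lambda>v. incr n h v - incr n h' v) n \<omega>
        = centered_sum (incr n h) n \<omega> - centered_sum (incr n h') n \<omega>"
      by (rule centered_sum_diff[symmetric, OF incr_integrable incr_integrable])
    also have "centered_sum (\<lambda>v. (h - h') / sqrt n * psi v) n \<omega> = (h - h') * score n \<omega>"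
      by (simp add: centered_sum_def score_def psi_mean_zero sum_distrib_left[symmetric] sum_divide_distrib[symmetric])
    finally show ?thesis by (simp add: remainder_def algebra_simps)
  qed
  show "integrable P (\<lambda>\<omega>. (remainder n h \<omega> - remainder n h' \<omega>)\<^sup>2)"
    unfolding eq by (rule centered_sum_second_moment(1)) (use g2 in auto)
  have "(\<integral>\<omega>. (centered_sum ?g n \<omega>)\<^sup>2 \<partial>P) \<le> n * (\<integral>v. (?g v)\<^sup>2 \<partial>Q)"
    by (rule centered_sum_second_moment(2)) (use g2 in auto)
  also have "\<dots> = lin_err n h h'"
    unfolding lin_err_def scaled[symmetric] by simp
  finally show "(\<integral>\<omega>. (remainder n h \<omega> - remainder n h' \<omega>)\<^sup>2 \<partial>P) \<le> lin_err n h h'"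
    unfolding eq .
qed

text \<open>Chaining for the linearized process, with bounds \<open>v n k\<close> that depend on \<open>n\<close>. At each level \<open>v n k\<close> is a
function of finitely many linearization errors and tends to 0; it is dominated by a summable geometric
sequence, so by Tannery's theorem the whole chaining sum tends to 0.\<close>

lemma uniform_linearization:
  assumes K: "0 < K" and e: "0 < e" and \<gamma>: "0 < \<gamma>"
  shows "\<forall>\<^sub>F n in sequentially. \<exists>A\<in>events. prob A \<le> \<gamma> \<and>
    (\<forall>\<omega>\<in>space P - A. \<forall>h. \<bar>h\<bar> \<le> K \<longrightarrow> \<bar>remainder n h \<omega>\<bar> < e)"
proof -
  define b where "b n k s = (\<Sum>i<2 ^ k. lin_err n (s * (real i + 1) / 2 ^ k) (s * real i / 2 ^ k))" for n k s
  \<comment> \<open>Adding the errors of the two half-lines gives a bound that serves for both.\<close>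
  define v where "v n k = sqrt (b n k K + b n k (- K))" for n k
  define B where "B k = sqrt 8 * C * K * sqrt (1/2) ^ k" for k :: nat
  have b0: "0 \<le> b n k s" for n k s unfolding b_def by (intro sum_nonneg lin_err_bounds)
  have b_le: "b n k s \<le> 4 * C\<^sup>2 * s\<^sup>2 / 2 ^ k" for n k s
  proof -
    have step: "s * (real i + 1) / 2 ^ k - s * real i / 2 ^ k = s / 2 ^ k" for i
      unfolding diff_divide_distrib[symmetric] by (simp add: ring_distribs)
    have "lin_err n (s * (real i + 1) / 2 ^ k) (s * real i / 2 ^ k) \<le> (2 * C * \<bar>s / 2 ^ k\<bar>)\<^sup>2" for i
      using lin_err_bounds(2)[of n "s * (real i + 1) / 2 ^ k" "s * real i / 2 ^ k"] unfolding step .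
    then have "b n k s \<le> (\<Sum>i<(2::nat) ^ k. (2 * C * \<bar>s / 2 ^ k\<bar>)\<^sup>2)" unfolding b_def by (intro sum_mono)
    also have "\<dots> = 4 * C\<^sup>2 * s\<^sup>2 / 2 ^ k"
      by (simp add: power_mult_distrib power_divide) (simp add: power2_eq_square)
    finally show ?thesis .
  qed
  have v0: "0 \<le> v n k" for n k by (simp add: v_def b0)
  have vB: "v n k \<le> B k" for n k
  proof -
    have "v n k \<le> sqrt (8 * C\<^sup>2 * K\<^sup>2 / 2 ^ k)"
      unfolding v_def using b_le[of n k K] b_le[of n k "- K"] by (intro real_sqrt_le_mono) simp
    also have "8 * C\<^sup>2 * K\<^sup>2 / 2 ^ k = (B k)\<^sup>2"
      unfolding B_def power_mult_distrib sqrt_half_power by simp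
    finally show ?thesis using C_nonneg K by (simp add: B_def)
  qed
  have sB: "summable B" unfolding B_def by (intro summable_mult summable_sqrt_half)
  have sv: "summable (v n)" for n
    by (rule summable_comparison_test'[OF sB, of 0]) (use v0 vB in simp)
  have "(\<lambda>n. v n k) \<longlonglongrightarrow> 0" for k
  proof -
    have "(\<lambda>n. v n k) \<longlonglongrightarrow> sqrt ((\<Sum>i<(2::nat) ^ k. 0) + (\<Sum>i<(2::nat) ^ k. 0))"
      unfolding v_def b_def by (intro tendsto_intros lin_err_tendsto)
    then show ?thesis by simp
  qed
  then have "(\<lambda>n. suminf (v n)) \<longlonglongrightarrow> suminf (\<lambda>k. 0)"
    using tannerys_theorem[of "\<lambda>k n. v n k" "\<lambda>_. 0" sequentially B] sB v0 vB
    by (simp add: always_eventually case_prod_unfold)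
  then have "(\<lambda>n. 2 * suminf (v n) / e) \<longlonglongrightarrow> 2 * 0 / e"
    using e by (intro tendsto_intros) auto
  then have "\<forall>\<^sub>F n in sequentially. 2 * suminf (v n) / e < \<gamma>"
    using \<gamma> by (intro order_tendstoD) auto
  then show ?thesis using eventually_ge_at_top[of 1]
  proof eventually_elim
    case (elim n)
    have "\<exists>A\<in>events. prob A \<le> 2 * suminf (v n) / e \<and>
      (\<forall>\<omega>\<in>space P - A. \<forall>h. \<bar>h\<bar> \<le> K \<longrightarrow> \<bar>remainder n h \<omega>\<bar> < e)"
    proof (rule two_sided_maximal_inequality)
      fix k :: nat and s assume s: "s \<in> {K, - K}"
      have "(\<Sum>i<2 ^ k. expectation (\<lambda>\<omega>. (remainder n (s * (real i + 1) / 2 ^ k) \<omega>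
          - remainder n (s * real i / 2 ^ k) \<omega>)\<^sup>2)) \<le> b n k s"
        unfolding b_def by (intro sum_mono remainder_second_moment(2)[OF elim(2)])
      also have "\<dots> \<le> b n k K + b n k (- K)" using s b0[of n k K] b0[of n k "- K"] by auto
      also have "\<dots> = (v n k)\<^sup>2" unfolding v_def using b0 by simp
      finally show "(\<Sum>i<2 ^ k. expectation (\<lambda>\<omega>. (remainder n (s * (real i + 1) / 2 ^ k) \<omega>
          - remainder n (s * real i / 2 ^ k) \<omega>)\<^sup>2)) \<le> (v n k)\<^sup>2" .
    next
      fix \<omega> assume "\<omega> \<in> space P"
      then show "continuous_on UNIV (\<lambda>h. remainder n h \<omega>)"
        unfolding remainder_def
        by (intro continuous_on_diff continuous_centered_sum_incr continuous_on_mult_right continuous_on_id)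
      show "remainder n 0 \<omega> = 0" by (simp add: remainder_def centered_sum_def)
    qed (use remainder_second_moment(1)[OF elim(2)] v0 sv e K in auto)
    then show ?case using elim(1) by (meson less_imp_le order_trans)
  qed
qed

lemma excess_quadratic_expansion:
  assumes K: "0 < K" and e: "0 < e"
  shows "\<forall>\<^sub>F n in sequentially. \<forall>h. \<bar>h\<bar> \<le> K \<longrightarrow> \<bar>n * excess (\<theta>0 + h / sqrt n) - a / 2 * h\<^sup>2\<bar> \<le> e"
proof -
  have "\<forall>\<^sub>F t in at 0. dist (excess (\<theta>0 + t) / t\<^sup>2) (a / 2) < e / K\<^sup>2"
    unfolding excess_def using K e by (intro tendstoD[OF curvature]) simp
  then obtain d where d: "0 < d"
    "\<And>t. t \<noteq> 0 \<Longrightarrow> \<bar>t\<bar> < d \<Longrightarrow> \<bar>excess (\<theta>0 + t) / t\<^sup>2 - a / 2\<bar> < e / K\<^sup>2"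
    by (auto simp: eventually_at dist_real_def)
  have "(\<lambda>n. K / sqrt (real n)) \<longlonglongrightarrow> 0"
    by (intro tendsto_divide_0[OF tendsto_const] filterlim_at_top_imp_at_infinity
        filterlim_compose[OF sqrt_at_top filterlim_real_sequentially])
  then have "\<forall>\<^sub>F n in sequentially. K / sqrt (real n) < d" using d(1) by (rule order_tendstoD)
  then show ?thesis using eventually_ge_at_top[of 1]
  proof eventually_elim
    case (elim n)
    show ?case
    proof (intro allI impI)
      fix h assume h: "\<bar>h\<bar> \<le> K"
      show "\<bar>n * excess (\<theta>0 + h / sqrt n) - a / 2 * h\<^sup>2\<bar> \<le> e"
      proof (cases "h = 0")
        case True
        then show ?thesis using e by (simp add: excess_def)
      next
        case False
        define t where "t = h / sqrt n"
        have t: "t \<noteq> 0" "t\<^sup>2 = h\<^sup>2 / n" using False elim(2) by (auto simp: t_def power_divide)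
        have "\<bar>t\<bar> \<le> K / sqrt n" using h by (simp add: t_def divide_right_mono)
        then have lt: "\<bar>excess (\<theta>0 + t) / t\<^sup>2 - a / 2\<bar> < e / K\<^sup>2" using d(2)[OF t(1)] elim(1) by simp
        have "n * excess (\<theta>0 + t) - a / 2 * h\<^sup>2 = h\<^sup>2 * (excess (\<theta>0 + t) / t\<^sup>2 - a / 2)"
          unfolding t(2) using False elim(2) by (simp add: field_simps)
        then have "\<bar>n * excess (\<theta>0 + t) - a / 2 * h\<^sup>2\<bar> = h\<^sup>2 * \<bar>excess (\<theta>0 + t) / t\<^sup>2 - a / 2\<bar>"
          by (simp add: abs_mult)
        also have "\<dots> \<le> K\<^sup>2 * (e / K\<^sup>2)"
          using lt h K by (intro mult_mono) (auto simp: abs_le_square_iff[symmetric])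
        finally show ?thesis using K by (simp add: t_def)
      qed
    qed
  qed
qed

lemma score_tail:
  assumes s: "0 < s"
  shows "{\<omega> \<in> space P. s \<le> \<bar>score n \<omega>\<bar>} \<in> events"
    and "prob {\<omega> \<in> space P. s \<le> \<bar>score n \<omega>\<bar>} \<le> (\<integral>v. (psi v)\<^sup>2 \<partial>Q) / s\<^sup>2"
proof -
  show "{\<omega> \<in> space P. s \<le> \<bar>score n \<omega>\<bar>} \<in> events" by measurable
  have "{\<omega> \<in> space P. s \<le> \<bar>score n \<omega>\<bar>} = {\<omega> \<in> space P. s\<^sup>2 \<le> (score n \<omega>)\<^sup>2}"
    using s by (simp add: abs_le_square_iff[symmetric])
  also have "prob \<dots> \<le> (\<integral>\<omega>. (score n \<omega>)\<^sup>2 \<partial>P) / s\<^sup>2"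
    by (rule integral_Markov_inequality_measure[OF score_second_moment(1) sets.top]) (use s in auto)
  also have "\<dots> \<le> (\<integral>v. (psi v)\<^sup>2 \<partial>Q) / s\<^sup>2"
    using score_second_moment(2) by (intro divide_right_mono) auto
  finally show "prob {\<omega> \<in> space P. s \<le> \<bar>score n \<omega>\<bar>} \<le> (\<integral>v. (psi v)\<^sup>2 \<partial>Q) / s\<^sup>2" .
qed

text \<open>Off three unlikely events the rescaled estimator and the vertex \<open>- score n \<omega> / a\<close> both lie in
\<open>[- K, K]\<close>, and there the local criterion is uniformly close to the parabola with this vertex.\<close>

lemma asymptotic_linearity:
  assumes min: "\<And>n. 1 \<le> n \<Longrightarrow>
      AE \<omega> in P. \<forall>\<theta>. (\<Sum>i<n. m (\<theta>hat n \<omega>) (V i \<omega>)) \<le> (\<Sum>i<n. m \<theta> (V i \<omega>))"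
    and \<epsilon>: "0 < \<epsilon>" and \<gamma>: "0 < \<gamma>"
  shows "\<forall>\<^sub>F n in sequentially. \<exists>A\<in>events. prob A \<le> \<gamma> \<and>
      (AE \<omega> in P. \<omega> \<notin> A \<longrightarrow> \<bar>sqrt n * (\<theta>hat n \<omega> - \<theta>0) + score n \<omega> / a\<bar> \<le> \<epsilon>)"
proof -
  define I where "I = (\<integral>v. (psi v)\<^sup>2 \<partial>Q)"
  have I: "0 < I" using psi_nondegenerate by (simp add: I_def)
  obtain k where k: "0 \<le> k" and rate: "\<And>n K. 1 \<le> n \<Longrightarrow> 0 < K \<Longrightarrow> \<exists>A\<in>events. prob A \<le> k / K \<and>
     (\<forall>\<omega>\<in>space P - A. \<forall>h. K \<le> \<bar>h\<bar> \<and> \<bar>h\<bar> \<le> R * sqrt n \<longrightarrow> 0 < (\<Sum>i<n. incr n h (V i \<omega>)))"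
    using root_n_rate by blast
  \<comment> \<open>Large enough for the estimator and for the vertex to leave \<open>[- K, K]\<close> with probability at most \<open>\<gamma> / 3\<close> each.\<close>
  define K where "K = 1 + 3 * k / \<gamma> + 3 * I / (\<gamma> * a\<^sup>2)"
  have K1: "1 \<le> K" "3 * k / \<gamma> \<le> K" "3 * I / (\<gamma> * a\<^sup>2) \<le> K"
    using k I \<gamma> a_pos by (auto simp: K_def)
  have K0: "0 < K" using K1(1) by simp
  have kK: "k / K \<le> \<gamma> / 3" using K1(2) K0 \<gamma> by (simp add: field_simps)
  have IK: "I / (a * K)\<^sup>2 \<le> \<gamma> / 3"
  proof -
    have "3 * I \<le> K * (\<gamma> * a\<^sup>2)" using K1(3) \<gamma> a_pos by (simp add: pos_divide_le_eq)
    also have "\<dots> \<le> (K * K) * (\<gamma> * a\<^sup>2)"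
      using K1(1) \<gamma> a_pos by (intro mult_right_mono) auto
    finally show ?thesis using K0 a_pos by (simp add: divide_simps power2_eq_square mult_ac)
  qed
  \<comment> \<open>The local criterion will be within \<open>2 e\<close> of the parabola, so its minimizer is within \<open>\<surd>(8 e / a) = \<epsilon>\<close> of the vertex.\<close>
  define e where "e = a * \<epsilon>\<^sup>2 / 8"
  have e: "0 < e" using a_pos \<epsilon> by (simp add: e_def)
  have \<gamma>3: "0 < \<gamma> / 3" using \<gamma> by simp
  have "\<forall>\<^sub>F n in sequentially. K / R \<le> sqrt (real n)"
    using filterlim_compose[OF sqrt_at_top filterlim_real_sequentially]
    by (simp add: filterlim_at_top)
  then show ?thesis
    using eventually_ge_at_top[of 1] uniform_linearization[OF K0 e \<gamma>3]
      excess_quadratic_expansion[OF K0 e]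
  proof (eventually_elim)
    case (elim n)
    then have n: "1 \<le> n" and KR: "K \<le> R * sqrt n"
      and quad: "\<And>h. \<bar>h\<bar> \<le> K \<Longrightarrow> \<bar>n * excess (\<theta>0 + h / sqrt n) - a / 2 * h\<^sup>2\<bar> \<le> e"
      using R_pos by (auto simp: pos_divide_le_eq mult.commute)
    from elim obtain A1 where A1: "A1 \<in> events" "prob A1 \<le> \<gamma> / 3"
      "\<And>\<omega> h. \<omega> \<in> space P - A1 \<Longrightarrow> \<bar>h\<bar> \<le> K \<Longrightarrow> \<bar>remainder n h \<omega>\<bar> < e" by blast
    obtain A2 where A2: "A2 \<in> events" "prob A2 \<le> k / K"
      "\<And>\<omega> h. \<omega> \<in> space P - A2 \<Longrightarrow> K \<le> \<bar>h\<bar> \<Longrightarrow> \<bar>h\<bar> \<le> R * sqrt n \<Longrightarrow> 0 < (\<Sum>i<n. incr n h (V i \<omega>))"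
      using rate[OF n K0] by blast
    define A3 where "A3 = {\<omega> \<in> space P. a * K \<le> \<bar>score n \<omega>\<bar>}"
    have aK: "0 < a * K" using a_pos K0 by simp
    have A3: "A3 \<in> events" "prob A3 \<le> \<gamma> / 3"
      unfolding A3_def using score_tail(1)[OF aK] order_trans[OF score_tail(2)[OF aK] IK[unfolded I_def]] by blast+
    define A where "A = A1 \<union> A2 \<union> A3"
    have "prob A \<le> prob A1 + prob A2 + prob A3"
      unfolding A_def using measure_Un_le[of "A1 \<union> A2" P A3] measure_Un_le[of A1 P A2] A1 A2 A3 by auto
    then have pA: "prob A \<le> \<gamma>" using A1(2) A2(2) A3(2) kK by linarith
    have A: "A \<in> events" using A1 A2 A3 by (auto simp: A_def)
    have "AE \<omega> in P. \<omega> \<notin> A \<longrightarrow> \<bar>sqrt n * (\<theta>hat n \<omega> - \<theta>0) + score n \<omega> / a\<bar> \<le> \<epsilon>"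
      using min[OF n] AE_V[OF m_far] AE_space
    proof eventually_elim
      case (elim \<omega>)
      show ?case
      proof
        assume "\<omega> \<notin> A"
        then have \<omega>: "\<omega> \<in> space P - A1" "\<omega> \<in> space P - A2" and sc: "\<bar>score n \<omega>\<bar> < a * K"
          using elim(3) by (auto simp: A_def A3_def)
        define Y where "Y h = (\<Sum>i<n. incr n h (V i \<omega>))" for h
        define h where "h = sqrt n * (\<theta>hat n \<omega> - \<theta>0)"
        have th: "\<theta>0 + h / sqrt n = \<theta>hat n \<omega>" using n by (simp add: h_def)
        have Ymin: "Y h \<le> Y h'" for h'
          using elim(1)[rule_format, of "\<theta>0 + h' / sqrt n"]
          unfolding Y_def incr_def th by (simp add: sum_subtractf)
        have Yh0: "Y h \<le> 0" using Ymin[of 0] by (simp add: Y_def)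
        have "\<bar>h\<bar> < K"
        proof (rule ccontr)
          assume "\<not> \<bar>h\<bar> < K"
          then have hK: "K \<le> \<bar>h\<bar>" by simp
          show False
          proof (cases "\<bar>h\<bar> \<le> R * sqrt n")
            case True
            then show ?thesis using A2(3)[OF \<omega>(2) hK] Yh0 by (simp add: Y_def)
          next
            case False
            then have "R \<le> \<bar>\<theta>hat n \<omega> - \<theta>0\<bar>" using n by (simp add: h_def abs_mult mult.commute)
            then have "m (\<theta>hat n \<omega>) (V i \<omega>) = m (\<theta>0 + R) (V i \<omega>)" for i using elim(2) by blast
            then have "Y h = Y (R * sqrt n)" unfolding Y_def incr_def th using n by simp
            moreover have "0 < Y (R * sqrt n)"
              unfolding Y_def using R_pos n KR by (intro A2(3)[OF \<omega>(2)]) auto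
            ultimately show ?thesis using Yh0 by simp
          qed
        qed
        have sc': "\<bar>- score n \<omega> / a\<bar> \<le> K"
          using sc a_pos by (simp add: abs_divide pos_divide_le_eq mult.commute)
        have approx: "\<bar>Y x - (x * score n \<omega> + a / 2 * x\<^sup>2)\<bar> \<le> 2 * e" if x: "\<bar>x\<bar> \<le> K" for x
        proof -
          have "Y x = (remainder n x \<omega> + x * score n \<omega>) + n * excess (\<theta>0 + x / sqrt n)"
            unfolding Y_def sum_incr remainder_def by simp
          then show ?thesis using A1(3)[OF \<omega>(1) x] quad[OF x] by linarith
        qed
        have "a / 2 * (h + score n \<omega> / a)\<^sup>2 \<le> 2 * (2 * e)"
          by (rule argmin_near_quadratic_argmin[OF approx _ Ymin sc' a_pos]) (use \<open>\<bar>h\<bar> < K\<close> in auto)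
        then have "(h + score n \<omega> / a)\<^sup>2 \<le> \<epsilon>\<^sup>2" using a_pos by (simp add: e_def)
        then show "\<bar>sqrt n * (\<theta>hat n \<omega> - \<theta>0) + score n \<omega> / a\<bar> \<le> \<epsilon>"
          using \<epsilon> by (simp add: h_def abs_le_square_iff[symmetric])
      qed
    qed
    then show ?case using A pA by blast
  qed
qed

theorem asymptotic_normality:
  assumes meas: "\<And>n. 1 \<le> n \<Longrightarrow> \<theta>hat n \<in> borel_measurable P"
    and min: "\<And>n. 1 \<le> n \<Longrightarrow>
      AE \<omega> in P. \<forall>\<theta>. (\<Sum>i<n. m (\<theta>hat n \<omega>) (V i \<omega>)) \<le> (\<Sum>i<n. m \<theta> (V i \<omega>))"
  shows "weak_conv_m (\<lambda>n. distr P borel (\<lambda>\<omega>. sqrt n * (\<theta>hat n \<omega> - \<theta>0)))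
    (density lborel (\<lambda>x. ennreal (normal_density 0 (sqrt (\<integral>v. (psi v)\<^sup>2 \<partial>Q) / a) x)))"
proof -
  define \<sigma> where "\<sigma> = sqrt (\<integral>v. (psi v)\<^sup>2 \<partial>Q)"
  have \<sigma>: "0 < \<sigma>" "\<sigma>\<^sup>2 = (\<integral>v. (psi v)\<^sup>2 \<partial>Q)" using psi_nondegenerate by (simp_all add: \<sigma>_def)
  let ?U = "\<lambda>i \<omega>. - psi (V i \<omega>)"
  let ?S = "\<lambda>n \<omega>. (\<Sum>i<n. ?U i \<omega>) / sqrt (n * \<sigma>\<^sup>2)"
  have mean: "expectation (?U i) = 0" for i
    using integral_V[OF psi_measurable] psi_mean_zero by simp
  have clt: "weak_conv_m (\<lambda>n. distr P borel (?S n)) std_normal_distribution"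
  proof (rule central_limit_theorem_zero_mean)
    show "indep_vars (\<lambda>i. borel) ?U UNIV"
      using indep_vars_compose2[OF indep_V, of "\<lambda>_ v. - psi v" "\<lambda>_. borel"] by simp
    show "expectation (?U i) = 0" for i by (rule mean)
    show "integrable P (\<lambda>\<omega>. (?U i \<omega>)\<^sup>2)" for i
      using integrable_V[OF psi_square_integrable] by simp
    show "variance (?U i) = \<sigma>\<^sup>2" for i
      using integral_V[of "\<lambda>v. (psi v)\<^sup>2" i] unfolding mean by (simp add: \<sigma>(2))
    show "distr P borel (?U i) = distr Q borel (\<lambda>v. - psi v)" for i
      using distr_distr[of "\<lambda>v. - psi v" Q borel "V i" P] by (simp add: distr_V comp_def)
  qed (rule \<sigma>(1))
  have "weak_conv_m (\<lambda>n. distr P borel (\<lambda>\<omega>. sqrt n * (\<theta>hat n \<omega> - \<theta>0)))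
    (density lborel (\<lambda>x. ennreal (normal_density 0 (\<sigma> / a) x)))"
  proof (rule weak_conv_normal_slutsky[OF _ _ _ clt])
    show "?S n \<in> borel_measurable P" for n
      using measurable_compose[OF V_measurable psi_measurable] by simp
    \<comment> \<open>At \<open>n = 0\<close> the variable is constantly 0.\<close>
    show "(\<lambda>\<omega>. sqrt n * (\<theta>hat n \<omega> - \<theta>0)) \<in> borel_measurable P" for n
      using meas[of n] by (cases "n = 0") auto
    show "0 < \<sigma> / a" using \<sigma> a_pos by simp
    fix \<epsilon> \<gamma> :: real assume eg: "0 < \<epsilon>" "0 < \<gamma>"
    have "\<sigma> / a * ?S n \<omega> = - (score n \<omega> / a)" for n \<omega>
      using \<sigma>(1) by (simp add: score_def real_sqrt_mult sum_negf)
    then show "\<forall>\<^sub>F n in sequentially. \<exists>A\<in>events. prob A \<le> \<gamma> \<and>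
      (AE \<omega> in P. \<omega> \<notin> A \<longrightarrow> \<bar>sqrt n * (\<theta>hat n \<omega> - \<theta>0) - \<sigma> / a * ?S n \<omega>\<bar> \<le> \<epsilon>)"
      using asymptotic_linearity[OF min eg] by simp
  qed
  then show ?thesis by (simp add: \<sigma>_def)
qed

end

section \<open>Expected absolute loss of a shifted even density\<close>

text \<open>For an even density \<open>\<phi>\<close> the expected loss \<open>E|Z - u| - E|Z|\<close>, called \<open>shift_loss u\<close> below, is smooth at 0 although
the absolute value is not. Taking the difference
inside the integral makes the integrand absolutely bounded by \<open>|u| \<phi> z\<close>.\<close>

locale even_density =
  fixes \<phi> :: "real \<Rightarrow> real"
  assumes phi_measurable [measurable]: "\<phi> \<in> borel_measurable borel"
    and phi_nonneg: "\<And>z. 0 \<le> \<phi> z" and phi_even: "\<And>z. \<phi> (- z) = \<phi> z"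
    and phi_integrable: "integrable lborel \<phi>"
    and phi_total: "(\<integral>z. \<phi> z \<partial>lborel) = 1"
begin

definition shift_loss :: "real \<Rightarrow> real" where
  "shift_loss u = (\<integral>z. \<phi> z * (\<bar>z - u\<bar> - \<bar>z\<bar>) \<partial>lborel)"

lemma integrable_shift_loss: "integrable lborel (\<lambda>z. \<phi> z * (\<bar>z - u\<bar> - \<bar>z\<bar>))"
proof (rule Bochner_Integration.integrable_bound)
  show "integrable lborel (\<lambda>z. \<phi> z * \<bar>u\<bar>)" using phi_integrable by simp
  have "\<bar>\<bar>z - u\<bar> - \<bar>z\<bar>\<bar> \<le> \<bar>u\<bar>" for z by linarith
  then show "AE z in lborel. norm (\<phi> z * (\<bar>z - u\<bar> - \<bar>z\<bar>)) \<le> norm (\<phi> z * \<bar>u\<bar>)"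
    using phi_nonneg by (intro AE_I2) (simp add: abs_mult mult_left_mono)
qed simp

lemma shift_loss_bound: "\<bar>shift_loss u\<bar> \<le> \<bar>u\<bar>"
proof -
  have b: "\<bar>\<bar>z - u\<bar> - \<bar>z\<bar>\<bar> \<le> \<bar>u\<bar>" for z by linarith
  have "\<bar>shift_loss u\<bar> \<le> (\<integral>z. \<bar>\<phi> z * (\<bar>z - u\<bar> - \<bar>z\<bar>)\<bar> \<partial>lborel)"
    unfolding shift_loss_def by (rule integral_abs_bound)
  also have "\<dots> \<le> (\<integral>z. \<phi> z * \<bar>u\<bar> \<partial>lborel)"
    using integrable_shift_loss[of u] phi_integrable b phi_nonneg
    by (intro integral_mono integrable_abs) (auto simp: abs_mult intro!: mult_left_mono)
  also have "\<dots> = \<bar>u\<bar>" using phi_total by simp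
  finally show ?thesis .
qed

lemma shift_loss_even: "shift_loss (- u) = shift_loss u"
proof -
  have "shift_loss u = (\<integral>z. \<phi> (- z) * (\<bar>- z - u\<bar> - \<bar>- z\<bar>) \<partial>lborel)"
    unfolding shift_loss_def by (subst lborel_integral_real_affine[where c="-1" and t=0]) auto
  also have "\<dots> = shift_loss (- u)"
  proof -
    have "\<bar>- z - u\<bar> - \<bar>- z\<bar> = \<bar>z - - u\<bar> - \<bar>z\<bar>" for z :: real by linarith
    then show ?thesis unfolding shift_loss_def phi_even by simp
  qed
  finally show ?thesis by simp
qed

text \<open>For \<open>z \<noteq> 0\<close> the difference \<open>|z - u| - |z|\<close> is \<open>- u sgn z\<close>, which has mean 0 by symmetry, plus the
triangle function \<open>T z = 2 (u - z)\<close> on \<open>[0, u]\<close>, which has total integral \<open>u\<^sup>2\<close>. Hence \<open>shift_loss u\<close> is \<open>u\<^sup>2\<close>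
times a weighted average of \<open>\<phi>\<close> over \<open>[0, u]\<close>.\<close>

lemma shift_loss_expansion_nonneg:
  assumes u: "0 \<le> u" and close: "\<And>z. 0 \<le> z \<Longrightarrow> z \<le> u \<Longrightarrow> \<bar>\<phi> z - \<phi> 0\<bar> \<le> e"
  shows "\<bar>shift_loss u - \<phi> 0 * u\<^sup>2\<bar> \<le> e * u\<^sup>2"
proof -
  define T where "T z = 2 * (u - z) * indicator {0..u} z" for z
  have [measurable]: "T \<in> borel_measurable borel" unfolding T_def by measurable
  have T: "integrable lborel T" "(\<integral>z. T z \<partial>lborel) = u\<^sup>2"
  proof -
    have D: "\<And>z. 0 \<le> z \<Longrightarrow> z \<le> u \<Longrightarrow> ((\<lambda>z. 2 * u * z - z\<^sup>2) has_real_derivative 2 * (u - z)) (at z)"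
      by (auto intro!: derivative_eq_intros)
    have c: "\<And>z. 0 \<le> z \<Longrightarrow> z \<le> u \<Longrightarrow> isCont (\<lambda>z. 2 * (u - z)) z" by (auto intro!: continuous_intros)
    show "integrable lborel T" "(\<integral>z. T z \<partial>lborel) = u\<^sup>2"
      unfolding T_def using has_bochner_integral_FTC_Icc_real[OF u D c] integral_FTC_Icc_real[OF u D c]
      by (auto simp: has_bochner_integral_iff power2_eq_square)
  qed
  have T0: "0 \<le> T z" for z by (simp add: T_def indicator_def)
  have sgn_int: "integrable lborel (\<lambda>z. \<phi> z * sgn z)"
    using phi_nonneg by (intro Bochner_Integration.integrable_bound[OF phi_integrable]) (auto simp: abs_mult sgn_if)
  have sgn_0: "(\<integral>z. \<phi> z * sgn z \<partial>lborel) = 0"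
  proof -
    have "(\<integral>z. \<phi> z * sgn z \<partial>lborel) = (\<integral>z. \<phi> (- z) * sgn (- z) \<partial>lborel)"
      by (subst lborel_integral_real_affine[where c="-1" and t=0]) auto
    also have "\<dots> = - (\<integral>z. \<phi> z * sgn z \<partial>lborel)" by (simp add: phi_even sgn_minus)
    finally show ?thesis by simp
  qed
  have ne: "AE z in lborel. z \<noteq> (0::real)" by (rule AE_lborel_singleton)
  have id: "AE z in lborel. \<phi> z * (\<bar>z - u\<bar> - \<bar>z\<bar>) + u * (\<phi> z * sgn z) = \<phi> z * T z"
    using ne
  proof eventually_elim
    case (elim z)
    have "\<bar>z - u\<bar> - \<bar>z\<bar> + u * sgn z = T z"
      using elim u by (auto simp: T_def indicator_def sgn_if)
    then show ?case by (metis distrib_left mult.left_commute)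
  qed
  have "integrable lborel (\<lambda>z. \<phi> z * (\<bar>z - u\<bar> - \<bar>z\<bar>) + u * (\<phi> z * sgn z))"
    using integrable_shift_loss sgn_int by simp
  then have phiT: "integrable lborel (\<lambda>z. \<phi> z * T z)"
    by (rule integrable_cong_AE_imp[OF _ _ id]) simp
  have "shift_loss u = (\<integral>z. \<phi> z * (\<bar>z - u\<bar> - \<bar>z\<bar>) + u * (\<phi> z * sgn z) \<partial>lborel)"
    using integrable_shift_loss sgn_int sgn_0 by (simp add: shift_loss_def)
  also have "\<dots> = (\<integral>z. \<phi> z * T z \<partial>lborel)"
    by (rule integral_cong_AE[OF _ _ id]) auto
  finally have "shift_loss u - \<phi> 0 * u\<^sup>2 = (\<integral>z. \<phi> z * T z - \<phi> 0 * T z \<partial>lborel)"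
    using phiT T by simp
  also have "\<bar>\<dots>\<bar> \<le> (\<integral>z. \<bar>\<phi> z * T z - \<phi> 0 * T z\<bar> \<partial>lborel)" by (rule integral_abs_bound)
  also have "\<dots> \<le> (\<integral>z. e * T z \<partial>lborel)"
  proof (rule integral_mono)
    show "integrable lborel (\<lambda>z. \<bar>\<phi> z * T z - \<phi> 0 * T z\<bar>)"
      using phiT T by (intro integrable_abs Bochner_Integration.integrable_diff) auto
    fix z
    show "\<bar>\<phi> z * T z - \<phi> 0 * T z\<bar> \<le> e * T z"
    proof (cases "z \<in> {0..u}")
      case True
      then show ?thesis using close[of z] T0[of z]
        by (simp only: left_diff_distrib[symmetric] abs_mult) (simp add: mult_right_mono)
    qed (simp add: T_def)
  qed (use T in simp)
  also have "\<dots> = e * u\<^sup>2" using T by simp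
  finally show ?thesis .
qed

lemma shift_loss_expansion:
  assumes "isCont \<phi> 0"
  shows "((\<lambda>u. shift_loss u / u\<^sup>2) \<longlongrightarrow> \<phi> 0) (at 0)"
proof (rule tendstoI)
  fix e :: real assume "0 < e"
  then have "0 < e / 2" by simp
  then obtain d where d: "0 < d" "\<And>z. \<bar>z\<bar> < d \<Longrightarrow> \<bar>\<phi> z - \<phi> 0\<bar> < e / 2"
    using assms unfolding isCont_def LIM_def dist_real_def
    by (metis abs_zero cancel_comm_monoid_add_class.diff_cancel diff_zero)
  have "\<bar>shift_loss u / u\<^sup>2 - \<phi> 0\<bar> < e" if u: "u \<noteq> 0" "\<bar>u\<bar> < d" for u
  proof -
    have "\<bar>shift_loss \<bar>u\<bar> - \<phi> 0 * \<bar>u\<bar>\<^sup>2\<bar> \<le> e / 2 * \<bar>u\<bar>\<^sup>2"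
      by (rule shift_loss_expansion_nonneg) (use d(2) u in \<open>auto intro: less_imp_le\<close>)
    moreover have "shift_loss \<bar>u\<bar> = shift_loss u" using shift_loss_even by (cases "0 \<le> u") auto
    ultimately have "\<bar>shift_loss u - \<phi> 0 * u\<^sup>2\<bar> \<le> e / 2 * u\<^sup>2" by simp
    moreover have "\<bar>shift_loss u / u\<^sup>2 - \<phi> 0\<bar> = \<bar>shift_loss u - \<phi> 0 * u\<^sup>2\<bar> / u\<^sup>2"
    proof -
      have "shift_loss u / u\<^sup>2 - \<phi> 0 = (shift_loss u - \<phi> 0 * u\<^sup>2) / u\<^sup>2"
        using u by (simp add: diff_divide_distrib)
      then show ?thesis by (simp add: abs_divide)
    qed
    ultimately have "\<bar>shift_loss u / u\<^sup>2 - \<phi> 0\<bar> \<le> e / 2" using u by (simp add: divide_le_eq)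
    then show ?thesis using \<open>0 < e\<close> by simp
  qed
  then show "\<forall>\<^sub>F u in at 0. dist (shift_loss u / u\<^sup>2) (\<phi> 0) < e"
    using d(1) by (auto simp: eventually_at dist_real_def)
qed

lemma shift_loss_quadratic_bound:
  assumes "isCont \<phi> 0"
  shows "\<exists>B\<ge>0. \<forall>u. \<bar>shift_loss u\<bar> \<le> B * u\<^sup>2"
proof -
  have "\<forall>\<^sub>F u in at 0. dist (shift_loss u / u\<^sup>2) (\<phi> 0) < 1"
    by (rule tendstoD[OF shift_loss_expansion[OF assms]]) simp
  then obtain d where d: "0 < d" "\<And>u. u \<noteq> 0 \<Longrightarrow> \<bar>u\<bar> < d \<Longrightarrow> \<bar>shift_loss u / u\<^sup>2 - \<phi> 0\<bar> < 1"
    by (auto simp: eventually_at dist_real_def)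
  define B where "B = max (\<phi> 0 + 1) (1 / d)"
  have "\<bar>shift_loss u\<bar> \<le> B * u\<^sup>2" for u
  proof -
    consider "u = 0" | "u \<noteq> 0" "\<bar>u\<bar> < d" | "u \<noteq> 0" "d \<le> \<bar>u\<bar>" by linarith
    then show ?thesis
    proof cases
      case 1
      then show ?thesis using shift_loss_bound[of 0] by simp
    next
      case 2
      then have "\<bar>shift_loss u / u\<^sup>2\<bar> \<le> \<phi> 0 + 1" using d(2)[of u] phi_nonneg[of 0] by linarith
      then have "\<bar>shift_loss u\<bar> / u\<^sup>2 \<le> B" by (simp add: abs_divide B_def)
      then show ?thesis using 2 by (simp add: divide_le_eq)
    next
      case 3
      have "\<bar>u\<bar> * 1 \<le> \<bar>u\<bar> * (\<bar>u\<bar> / d)" using 3 d(1) by (intro mult_left_mono) auto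
      also have "\<dots> = 1 / d * u\<^sup>2" by (simp add: power2_eq_square)
      also have "\<dots> \<le> B * u\<^sup>2" by (intro mult_right_mono) (auto simp: B_def)
      finally show ?thesis using shift_loss_bound[of u] by simp
    qed
  qed
  moreover have "0 \<le> B" using phi_nonneg[of 0] by (simp add: B_def)
  ultimately show ?thesis by blast
qed

end

section \<open>Template matching with the absolute loss\<close>

lemma has_real_derivative_abs:
  fixes z :: real
  assumes "z \<noteq> 0"
  shows "((\<lambda>y. \<bar>y\<bar>) has_real_derivative sgn z) (at z)"
proof -
  have ev: "\<forall>\<^sub>F y in nhds z. \<bar>y\<bar> = sgn z * y"
  proof (cases "0 < z")
    case True
    then have "\<forall>\<^sub>F y in nhds z. 0 < y" using order_tendstoD(1)[OF tendsto_ident_at[of z]] eventually_nhds_in_open[of "{0<..}" z] by simp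
    then show ?thesis by eventually_elim (use True in simp)
  next
    case False
    then have "z < 0" using assms by simp
    then have "\<forall>\<^sub>F y in nhds z. y < 0" using eventually_nhds_in_open[of "{..<0}" z] by simp
    then show ?thesis by eventually_elim (use \<open>z < 0\<close> in simp)
  qed
  have "((\<lambda>y. sgn z * y) has_real_derivative sgn z) (at z)"
    by (auto intro!: derivative_eq_intros)
  then show ?thesis by (subst DERIV_cong_ev[OF refl ev refl])
qed

lemma compact_tsupport_bound:
  assumes "compact (tsupport g)"
  shows "\<exists>A\<ge>0. \<forall>y. g y \<noteq> 0 \<longrightarrow> \<bar>y\<bar> \<le> A"
proof -
  obtain A where A: "\<And>y. y \<in> tsupport g \<Longrightarrow> norm y \<le> A"
    using compact_imp_bounded[OF assms] by (auto simp: bounded_iff)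
  have "y \<in> tsupport g" if "g y \<noteq> 0" for y
    unfolding tsupport_def using that closure_subset by (fastforce simp: support_on_def)
  then have "\<bar>y\<bar> \<le> max A 0" if "g y \<noteq> 0" for y
    using A[of y] that by force
  then show ?thesis by (intro exI[of _ "max A 0"]) auto
qed

locale lipschitz_template_model = basic_template_model P X Z f lam \<phi> \<theta>s "\<lambda>y. \<bar>y\<bar>"
  for P :: "'w measure" and X Z f lam \<phi> \<theta>s +
  fixes C :: real
  assumes f_Lipschitz: "C-lipschitz_on UNIV f"
    and phi_cont: "isCont \<phi> 0" and phi_0_pos: "0 < \<phi> 0"
    and information_pos: "0 < (\<integral>\<omega>. (deriv f (X 0 \<omega> - \<theta>s))\<^sup>2 \<partial>P)"
begin

definition design_law :: "real measure" where "design_law = density lborel (\<lambda>x. ennreal (lam x))"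
definition noise_law :: "real measure" where "noise_law = density lborel (\<lambda>z. ennreal (\<phi> z))"
definition Q :: "(real \<times> real) measure" where "Q = design_law \<Otimes>\<^sub>M noise_law"

text \<open>The criterion as a function of the independent pair of design point and noise variable; the response is
recovered as \<open>f (x - \<theta>s) + z\<close>.\<close>

definition mcrit :: "real \<Rightarrow> real \<times> real \<Rightarrow> real" where
  "mcrit \<theta> v = crit (\<lambda>y. \<bar>y\<bar>) f \<theta> (fst v) (f (fst v - \<theta>s) + snd v)"

text \<open>A Borel version of the derivative: it agrees with \<open>deriv f\<close> wherever \<open>f\<close> is differentiable, and as a limit
along a fixed sequence it is measurable.\<close>

definition Df :: "real \<Rightarrow> real" where
  "Df y = lim (\<lambda>n. (f (y + inverse (real (Suc n))) - f y) / inverse (real (Suc n)))"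

definition psi :: "real \<times> real \<Rightarrow> real" where
  "psi v = sgn (snd v) * Df (fst v - \<theta>s)"

definition information :: real where
  "information = (\<integral>\<omega>. (deriv f (X 0 \<omega> - \<theta>s))\<^sup>2 \<partial>P)"

lemma lam_measurable [measurable]: "lam \<in> borel_measurable borel"
  using distributed_real_measurable[OF _ X_distributed] lam_nonneg by simp

lemma noise_density_measurable [measurable]: "\<phi> \<in> borel_measurable borel"
  using distributed_real_measurable[OF _ Z_distributed] phi_nonneg by simp

lemma f_measurable [measurable]: "f \<in> borel_measurable borel"
  using lipschitz_on_continuous_on[OF f_Lipschitz] by (rule borel_measurable_continuous_onI)

lemma X_measurable [measurable]: "X i \<in> borel_measurable P"
  using distributed_measurable[OF X_distributed] by simp

lemma Z_measurable [measurable]: "Z i \<in> borel_measurable P"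
  using distributed_measurable[OF Z_distributed] by simp

lemma f_Lip: "\<bar>f x - f y\<bar> \<le> C * \<bar>x - y\<bar>"
  using lipschitz_onD[OF f_Lipschitz, of x y] by (simp add: dist_real_def)

lemma design_law_eq: "design_law = distr P borel (X i)"
proof -
  have "distr P borel (X i) = distr P lborel (X i)" by (rule distr_cong) auto
  then show ?thesis using distributed_distr_eq_density[OF X_distributed] by (simp add: design_law_def)
qed

lemma noise_law_eq: "noise_law = distr P borel (Z i)"
proof -
  have "distr P borel (Z i) = distr P lborel (Z i)" by (rule distr_cong) auto
  then show ?thesis using distributed_distr_eq_density[OF Z_distributed] by (simp add: noise_law_def)
qed

lemma sets_design_law [measurable_cong, simp]: "sets design_law = sets borel"
  and sets_noise_law [measurable_cong, simp]: "sets noise_law = sets borel"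
  by (simp_all add: design_law_def noise_law_def)

lemma sets_Q [measurable_cong, simp]: "sets Q = sets (borel \<Otimes>\<^sub>M borel)"
  unfolding Q_def by (rule sets_pair_measure_cong) simp_all

sublocale design_law: prob_space design_law
  unfolding design_law_eq[of 0] by (rule prob_space_distr) simp

sublocale noise_law: prob_space noise_law
  unfolding noise_law_eq[of 0] by (rule prob_space_distr) simp

sublocale joint: pair_prob_space design_law noise_law ..

lemma prob_space_Q: "prob_space Q"
  unfolding Q_def by (rule joint.prob_space_axioms)

sublocale even_density \<phi>
proof
  have "(\<integral>\<^sup>+z. ennreal (\<phi> z) \<partial>lborel) = ennreal 1"
    using noise_law.emeasure_space_1 by (simp add: noise_law_def emeasure_density space_density)
  then show "integrable lborel \<phi>" "(\<integral>z. \<phi> z \<partial>lborel) = 1"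
    using nn_integral_eq_integrable[of \<phi> lborel 1] phi_nonneg by auto
qed (use phi_nonneg phi_even in auto)

text \<open>Grouping the independent family, indexed by a disjoint sum, into pairs gives independent pairs; within
a pair, independence makes the joint law the product of the marginal laws.\<close>

lemma iid_sample_Q: "iid_sample P Q (\<lambda>i \<omega>. (X i \<omega>, Z i \<omega>))"
proof -
  interpret Q: prob_space Q by (rule prob_space_Q)
  let ?W = "case_sum X Z" and ?K = "\<lambda>i::nat. {Inl i, Inr i} :: (nat + nat) set"
  have "indep_vars (\<lambda>j. PiM (?K j) (\<lambda>_. borel)) (\<lambda>j \<omega>. restrict (\<lambda>i. ?W i \<omega>) (?K j)) UNIV"
    by (rule indep_vars_restrict[OF indep]) (auto simp: disjoint_family_on_def)
  then have "indep_vars (\<lambda>_. Q) (\<lambda>j \<omega>. (\<lambda>g. (g (Inl j), g (Inr j))) (restrict (\<lambda>i. ?W i \<omega>) (?K j))) UNIV"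
  proof (rule indep_vars_compose2)
    fix j :: nat
    show "(\<lambda>g. (g (Inl j), g (Inr j))) \<in> PiM (?K j) (\<lambda>_. borel) \<rightarrow>\<^sub>M Q"
      unfolding measurable_cong_sets[OF refl sets_Q]
      by (intro measurable_Pair measurable_component_singleton) auto
  qed
  then have ind: "indep_vars (\<lambda>_. Q) (\<lambda>i \<omega>. (X i \<omega>, Z i \<omega>)) UNIV" by simp
  have "distr P Q (\<lambda>\<omega>. (X i \<omega>, Z i \<omega>)) = Q" for i
  proof -
    have "indep_var (PiM {Inl i} (\<lambda>_. borel)) (\<lambda>\<omega>. restrict (\<lambda>k. ?W k \<omega>) {Inl i})
        (PiM {Inr i} (\<lambda>_. borel)) (\<lambda>\<omega>. restrict (\<lambda>k. ?W k \<omega>) {Inr i})"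
      by (rule indep_var_restrict[OF indep]) auto
    then have "indep_var borel ((\<lambda>g. g (Inl i)) \<circ> (\<lambda>\<omega>. restrict (\<lambda>k. ?W k \<omega>) {Inl i}))
        borel ((\<lambda>g. g (Inr i)) \<circ> (\<lambda>\<omega>. restrict (\<lambda>k. ?W k \<omega>) {Inr i}))"
      by (rule indep_var_compose) (auto intro!: measurable_component_singleton)
    then have "indep_var borel (X i) borel (Z i)" by (simp add: comp_def)
    then have "distr P borel (X i) \<Otimes>\<^sub>M distr P borel (Z i) = distr P (borel \<Otimes>\<^sub>M borel) (\<lambda>\<omega>. (X i \<omega>, Z i \<omega>))"
      unfolding indep_var_distribution_eq by simp
    moreover have "distr P Q (\<lambda>\<omega>. (X i \<omega>, Z i \<omega>)) = distr P (borel \<Otimes>\<^sub>M borel) (\<lambda>\<omega>. (X i \<omega>, Z i \<omega>))"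
      by (rule distr_cong) auto
    ultimately show ?thesis unfolding Q_def design_law_eq[of i] noise_law_eq[of i] by simp
  qed
  then show ?thesis using ind by unfold_locales
qed

sublocale smp: iid_sample P Q "\<lambda>i \<omega>. (X i \<omega>, Z i \<omega>)"
  by (rule iid_sample_Q)

lemma AE_Q_fst:
  assumes "AE x in design_law. p x" shows "AE v in Q. p (fst v)"
proof -
  have "AE x in distr Q design_law fst. p x"
    unfolding Q_def noise_law.distr_pair_fst by (rule assms)
  then show ?thesis by (rule AE_distrD[rotated]) (simp add: Q_def)
qed

lemma AE_design_law: "AE x in lborel. p x \<Longrightarrow> AE x in design_law. p x"
  unfolding design_law_def by (subst AE_density) auto

lemma Df_eq: "f differentiable (at y) \<Longrightarrow> (f has_real_derivative Df y) (at y)"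
proof -
  assume "f differentiable (at y)"
  then obtain D where D: "(f has_real_derivative D) (at y)" using real_differentiable_def by blast
  then have "((\<lambda>h. (f (y + h) - f y) / h) \<longlongrightarrow> D) (at 0)" by (simp add: DERIV_def)
  moreover have "filterlim (\<lambda>n. inverse (real (Suc n))) (at 0) sequentially"
    using LIMSEQ_inverse_real_of_nat by (simp add: filterlim_at)
  ultimately have "(\<lambda>n. (f (y + inverse (real (Suc n))) - f y) / inverse (real (Suc n))) \<longlonglongrightarrow> D"
    by (rule filterlim_compose)
  then have "Df y = D" unfolding Df_def by (rule limI)
  then show ?thesis using D by simp
qed

lemma Df_measurable [measurable]: "Df \<in> borel_measurable borel"
  unfolding Df_def by measurable

lemma AE_Df: "AE x in design_law. (f has_real_derivative Df (x - \<theta>s)) (at (x - \<theta>s))"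
proof (rule AE_design_law)
  have "C-lipschitz_on UNIV (\<lambda>x. f (x + - \<theta>s))"
    using f_Lip lipschitz_on_nonneg[OF f_Lipschitz]
    by (intro lipschitz_onI) (auto simp: dist_real_def intro: order_trans[OF f_Lip])
  from lipschitz_AE_differentiable[OF this]
  show "AE x in lborel. (f has_real_derivative Df (x - \<theta>s)) (at (x - \<theta>s))"
  proof eventually_elim
    case (elim x)
    then obtain D where "((\<lambda>x. f (x + - \<theta>s)) has_real_derivative D) (at x)"
      using real_differentiable_def by blast
    then have "(f has_real_derivative D) (at (x + - \<theta>s))" by (simp only: DERIV_shift)
    then show ?case using Df_eq real_differentiable_def by fastforce
  qed
qed

lemma AE_Z_nonzero: "AE v in Q. snd v \<noteq> 0"
  unfolding Q_def
proof (rule joint.AE_pair_measure)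
  have "AE z in noise_law. z \<noteq> 0"
    unfolding noise_law_def using AE_lborel_singleton[of "0::real"] by (subst AE_density) auto
  then show "AE x in design_law. AE z in noise_law. snd (x, z) \<noteq> 0" by simp
qed measurable

lemma mcrit_eq: "mcrit \<theta> (x, z) = \<bar>z - (f (x - \<theta>) - f (x - \<theta>s))\<bar>"
  by (simp add: mcrit_def crit_def)

lemma mcrit_measurable [measurable]: "mcrit \<theta> \<in> borel_measurable Q"
  unfolding mcrit_def crit_def by measurable

lemma psi_measurable [measurable]: "psi \<in> borel_measurable Q"
  unfolding psi_def by measurable

lemma mcrit_Lipschitz: "\<bar>mcrit \<theta> v - mcrit \<theta>' v\<bar> \<le> C * \<bar>\<theta> - \<theta>'\<bar>"
proof -
  obtain x z where v: "v = (x, z)" by (cases v)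
  have "\<bar>mcrit \<theta> v - mcrit \<theta>' v\<bar> \<le> \<bar>f (x - \<theta>) - f (x - \<theta>')\<bar>"
    unfolding v mcrit_eq by linarith
  also have "\<dots> \<le> C * \<bar>(x - \<theta>) - (x - \<theta>')\<bar>" by (rule f_Lip)
  finally show ?thesis by (simp add: abs_minus_commute)
qed

lemma mcrit_deriv: "AE v in Q. ((\<lambda>\<theta>. mcrit \<theta> v) has_real_derivative psi v) (at \<theta>s)"
  using AE_Q_fst[OF AE_Df] AE_Z_nonzero
proof eventually_elim
  case (elim v)
  obtain x z where v: "v = (x, z)" by (cases v)
  have D: "(f has_real_derivative Df (x - \<theta>s)) (at (x - \<theta>s))" and z: "z \<noteq> 0" using elim v by auto
  have "((\<lambda>\<theta>. x - \<theta>) has_real_derivative -1) (at \<theta>s)" by (auto intro!: derivative_eq_intros)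
  from DERIV_chain2[OF D this]
  have "((\<lambda>\<theta>. f (x - \<theta>s) + z - f (x - \<theta>)) has_real_derivative Df (x - \<theta>s)) (at \<theta>s)"
    by (auto intro!: derivative_eq_intros)
  from DERIV_chain2[OF _ this, of "\<lambda>y. \<bar>y\<bar>" "sgn z"] has_real_derivative_abs[OF z]
  show ?case by (simp add: v psi_def mcrit_def crit_def)
qed

text \<open>Once \<open>\<theta>\<close> is so far from \<open>\<theta>s\<close> that \<open>x - \<theta>\<close> leaves the support of \<open>f\<close> for every \<open>x\<close> in the
support of the design density, the criterion is \<open>|y|\<close>, whatever \<open>\<theta>\<close> is.\<close>

lemma mcrit_far:
  "\<exists>R>0. AE v in Q. \<forall>\<theta>. R \<le> \<bar>\<theta> - \<theta>s\<bar> \<longrightarrow> mcrit \<theta> v = mcrit (\<theta>s + R) v"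
proof -
  obtain A where A: "0 \<le> A" "\<And>y. f y \<noteq> 0 \<Longrightarrow> \<bar>y\<bar> \<le> A"
    using compact_tsupport_bound[OF f_compact_support] by blast
  obtain B where B: "0 \<le> B" "\<And>y. lam y \<noteq> 0 \<Longrightarrow> \<bar>y\<bar> \<le> B"
    using compact_tsupport_bound[OF lam_compact_support] by blast
  \<comment> \<open>If \<open>|\<theta> - \<theta>s| \<ge> R\<close> and \<open>|x| \<le> B\<close>, then \<open>|x - \<theta>| > A\<close>.\<close>
  define R where "R = A + B + 1 + \<bar>\<theta>s\<bar>"
  have "AE x in design_law. \<bar>x\<bar> \<le> B"
    unfolding design_law_def using B(2) by (subst AE_density, simp) (metis (mono_tags, lifting) AE_I2 ennreal_0 less_irrefl)
  from AE_Q_fst[OF this]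
  have "AE v in Q. \<forall>\<theta>. R \<le> \<bar>\<theta> - \<theta>s\<bar> \<longrightarrow> mcrit \<theta> v = mcrit (\<theta>s + R) v"
  proof eventually_elim
    case (elim v)
    obtain x z where v: "v = (x, z)" by (cases v)
    have "f (x - \<theta>) = 0" if "R \<le> \<bar>\<theta> - \<theta>s\<bar>" for \<theta>
    proof (rule ccontr)
      assume "f (x - \<theta>) \<noteq> 0"
      then have "\<bar>x - \<theta>\<bar> \<le> A" by (rule A(2))
      then show False using that elim by (simp add: R_def v)
    qed
    moreover have "R \<le> \<bar>\<theta>s + R - \<theta>s\<bar>" using A(1) B(1) by (simp add: R_def)
    ultimately show ?case unfolding v mcrit_eq by metis
  qed
  moreover have "0 < R" using A(1) B(1) by (simp add: R_def)
  ultimately show ?thesis by blast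
qed

lemma mcrit_sample: "mcrit \<theta> (X i \<omega>, Z i \<omega>) = crit (\<lambda>y. \<bar>y\<bar>) f \<theta> (X i \<omega>) (obs_Y f \<theta>s X Z i \<omega>)"
  by (simp add: mcrit_def obs_Y_def)

lemma excess_eq_pop_crit:
  "(\<integral>v. mcrit \<theta> v - mcrit \<theta>s v \<partial>Q)
    = pop_crit P (\<lambda>y. \<bar>y\<bar>) f X (obs_Y f \<theta>s X Z) \<theta> - pop_crit P (\<lambda>y. \<bar>y\<bar>) f X (obs_Y f \<theta>s X Z) \<theta>s"
proof -
  have "(\<integral>v. mcrit \<theta> v - mcrit \<theta>s v \<partial>Q)
      = (\<integral>\<omega>. mcrit \<theta> (X 0 \<omega>, Z 0 \<omega>) - mcrit \<theta>s (X 0 \<omega>, Z 0 \<omega>) \<partial>P)"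
    by (rule smp.integral_V[symmetric]) simp
  also have "\<dots> = pop_crit P (\<lambda>y. \<bar>y\<bar>) f X (obs_Y f \<theta>s X Z) \<theta> - pop_crit P (\<lambda>y. \<bar>y\<bar>) f X (obs_Y f \<theta>s X Z) \<theta>s"
    unfolding mcrit_sample pop_crit_def by (rule Bochner_Integration.integral_diff[OF crit_integrable crit_integrable])
  finally show ?thesis .
qed

lemma mcrit_separation:
  assumes "0 < \<delta>"
  shows "\<exists>\<eta>>0. \<forall>\<theta>. \<delta> \<le> \<bar>\<theta> - \<theta>s\<bar> \<longrightarrow> \<eta> \<le> (\<integral>v. mcrit \<theta> v - mcrit \<theta>s v \<partial>Q)"
proof -
  let ?p = "pop_crit P (\<lambda>y. \<bar>y\<bar>) f X (obs_Y f \<theta>s X Z)"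
  let ?I = "INF \<theta>\<in>{\<theta>. \<delta> \<le> \<bar>\<theta> - \<theta>s\<bar>}. ?p \<theta>"
  have "bdd_below (?p ` {\<theta>. \<delta> \<le> \<bar>\<theta> - \<theta>s\<bar>})"
    by (rule bdd_belowI2[where m=0]) (auto simp: pop_crit_def crit_def intro!: Bochner_Integration.integral_nonneg)
  then have "?I \<le> ?p \<theta>" if "\<delta> \<le> \<bar>\<theta> - \<theta>s\<bar>" for \<theta>
    using that by (intro cINF_lower) auto
  moreover have "0 < ?I - ?p \<theta>s" using well_separated[OF assms] by simp
  ultimately show ?thesis
    unfolding excess_eq_pop_crit by (intro exI[of _ "?I - ?p \<theta>s"]) auto
qed

text \<open>The strict positivity of the information also makes its integrand integrable, hence measurable, because the
integral of a non-integrable function is 0 by convention.\<close>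

lemma information_eq: "(\<integral>x. (Df (x - \<theta>s))\<^sup>2 \<partial>design_law) = information"
proof -
  have int: "integrable P (\<lambda>\<omega>. (deriv f (X 0 \<omega> - \<theta>s))\<^sup>2)"
    using information_pos not_integrable_integral_eq[of P "\<lambda>\<omega>. (deriv f (X 0 \<omega> - \<theta>s))\<^sup>2"] by force
  have "AE \<omega> in P. (f has_real_derivative Df (X 0 \<omega> - \<theta>s)) (at (X 0 \<omega> - \<theta>s))"
    by (rule AE_distrD[OF X_measurable[of 0]]) (unfold design_law_eq[of 0, symmetric], rule AE_Df)
  then have eq: "AE \<omega> in P. (deriv f (X 0 \<omega> - \<theta>s))\<^sup>2 = (Df (X 0 \<omega> - \<theta>s))\<^sup>2"
    by eventually_elim (simp add: DERIV_imp_deriv)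
  have "information = (\<integral>\<omega>. (Df (X 0 \<omega> - \<theta>s))\<^sup>2 \<partial>P)"
    unfolding information_def using int by (intro integral_cong_AE[OF _ _ eq]) auto
  also have "\<dots> = (\<integral>x. (Df (x - \<theta>s))\<^sup>2 \<partial>design_law)"
    unfolding design_law_eq[of 0] by (rule integral_distr[symmetric]) auto
  finally show ?thesis by simp
qed

lemma psi_second_moment: "(\<integral>v. (psi v)\<^sup>2 \<partial>Q) = information"
proof -
  have eq: "AE v in Q. (psi v)\<^sup>2 = (Df (fst v - \<theta>s))\<^sup>2"
    using AE_Z_nonzero by eventually_elim (simp add: psi_def power_mult_distrib sgn_if)
  have "(\<integral>v. (psi v)\<^sup>2 \<partial>Q) = (\<integral>v. (Df (fst v - \<theta>s))\<^sup>2 \<partial>Q)"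
    by (rule integral_cong_AE[OF _ _ eq]) auto
  also have "\<dots> = (\<integral>x. (Df (x - \<theta>s))\<^sup>2 \<partial>distr Q design_law fst)"
    by (rule integral_distr[symmetric]) (auto simp: Q_def)
  also have "distr Q design_law fst = design_law" unfolding Q_def by (rule noise_law.distr_pair_fst)
  finally show ?thesis by (simp add: information_eq)
qed

lemma excess_eq_shift_loss:
  "(\<integral>v. mcrit \<theta> v - mcrit \<theta>s v \<partial>Q) = (\<integral>x. shift_loss (f (x - \<theta>) - f (x - \<theta>s)) \<partial>design_law)"
proof -
  have "integrable Q (\<lambda>v. mcrit \<theta> v - mcrit \<theta>s v)"
    using mcrit_Lipschitz[of \<theta> _ \<theta>s] by (intro smp.Q.integrable_const_bound[where B="C * \<bar>\<theta> - \<theta>s\<bar>"]) auto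
  then have "(\<integral>v. mcrit \<theta> v - mcrit \<theta>s v \<partial>Q) = (\<integral>x. \<integral>z. mcrit \<theta> (x, z) - mcrit \<theta>s (x, z) \<partial>noise_law \<partial>design_law)"
    unfolding Q_def by (rule joint.integral_fst'[symmetric])
  also have "\<dots> = (\<integral>x. shift_loss (f (x - \<theta>) - f (x - \<theta>s)) \<partial>design_law)"
    unfolding noise_law_def shift_loss_def mcrit_eq
    by (subst integral_density) (auto simp: phi_nonneg)
  finally show ?thesis .
qed

lemma shift_loss_measurable [measurable]: "shift_loss \<in> borel_measurable borel"
  unfolding shift_loss_def by measurable

text \<open>Writing \<open>shift_loss y = g y * y\<^sup>2\<close> with \<open>g\<close> continuous at 0 and \<open>g 0 = \<phi> 0\<close>, the integrand is
\<open>g (u n x)\<close> times the square of a difference quotient of \<open>f\<close>. It converges to \<open>\<phi> 0\<close> times the squared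
derivative almost everywhere, and the global quadratic bound on \<open>shift_loss\<close> dominates it.\<close>

lemma mcrit_curvature:
  "((\<lambda>t. (\<integral>v. mcrit (\<theta>s + t) v - mcrit \<theta>s v \<partial>Q) / t\<^sup>2) \<longlongrightarrow> 2 * \<phi> 0 * information / 2) (at 0)"
  unfolding tendsto_at_iff_sequentially
proof (intro allI impI)
  fix s :: "nat \<Rightarrow> real" assume s: "\<forall>i. s i \<in> UNIV - {0}" "s \<longlonglongrightarrow> 0"
  have s0: "s n \<noteq> 0" for n using s(1) by simp
  obtain B where B: "0 \<le> B" "\<And>u. \<bar>shift_loss u\<bar> \<le> B * u\<^sup>2"
    using shift_loss_quadratic_bound[OF phi_cont] by blast
  define u where "u n x = f (x - (\<theta>s + s n)) - f (x - \<theta>s)" for n x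
  have [measurable]: "u n \<in> borel_measurable borel" for n unfolding u_def by measurable
  have u_le: "\<bar>u n x\<bar> \<le> C * \<bar>s n\<bar>" for n x
    unfolding u_def using f_Lip[of "x - (\<theta>s + s n)" "x - \<theta>s"] by simp
  define g where "g y = (if y = 0 then \<phi> 0 else shift_loss y / y\<^sup>2)" for y
  have g: "shift_loss y = g y * y\<^sup>2" for y
    using shift_loss_bound[of 0] by (simp add: g_def)
  have g_cont: "isCont g 0"
    unfolding isCont_def
  proof (rule Lim_transform_eventually)
    show "((\<lambda>u. shift_loss u / u\<^sup>2) \<longlongrightarrow> g 0) (at 0)"
      using shift_loss_expansion[OF phi_cont] by (simp add: g_def)
    show "\<forall>\<^sub>F u in at 0. shift_loss u / u\<^sup>2 = g u" by (simp add: eventually_at_filter g_def)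
  qed
  have "(\<lambda>n. \<integral>x. shift_loss (u n x) / (s n)\<^sup>2 \<partial>design_law) \<longlonglongrightarrow> (\<integral>x. \<phi> 0 * (Df (x - \<theta>s))\<^sup>2 \<partial>design_law)"
  proof (rule integral_dominated_convergence[where w="\<lambda>_. B * C\<^sup>2"])
    show "AE x in design_law. (\<lambda>n. shift_loss (u n x) / (s n)\<^sup>2) \<longlonglongrightarrow> \<phi> 0 * (Df (x - \<theta>s))\<^sup>2"
      using AE_Df
    proof eventually_elim
      case (elim x)
      have "filterlim (\<lambda>n. - s n) (at 0) sequentially"
        using s0 tendsto_minus[OF s(2)] by (simp add: filterlim_at)
      with elim have "(\<lambda>n. (f (x - \<theta>s + - s n) - f (x - \<theta>s)) / (- s n)) \<longlonglongrightarrow> Df (x - \<theta>s)"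
        unfolding DERIV_def by (rule filterlim_compose)
      then have q: "(\<lambda>n. u n x / (- s n)) \<longlonglongrightarrow> Df (x - \<theta>s)"
        by (simp add: u_def algebra_simps)
      have "(\<lambda>n. C * \<bar>s n\<bar>) \<longlonglongrightarrow> C * \<bar>0\<bar>" by (intro tendsto_intros s)
      then have "(\<lambda>n. C * \<bar>s n\<bar>) \<longlonglongrightarrow> 0" by simp
      then have "(\<lambda>n. u n x) \<longlonglongrightarrow> 0"
        by (rule Lim_null_comparison[rotated]) (simp add: u_le)
      then have "(\<lambda>n. g (u n x)) \<longlonglongrightarrow> g 0" by (rule isCont_tendsto_compose[OF g_cont])
      then have "(\<lambda>n. g (u n x) * (u n x / (- s n))\<^sup>2) \<longlonglongrightarrow> g 0 * (Df (x - \<theta>s))\<^sup>2"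
        using q by (intro tendsto_intros)
      then show ?case by (simp add: g power_divide g_def[of 0])
    qed
    show "AE x in design_law. norm (shift_loss (u n x) / (s n)\<^sup>2) \<le> B * C\<^sup>2" for n
    proof (rule AE_I2)
      fix x
      have "(u n x)\<^sup>2 \<le> (C * \<bar>s n\<bar>)\<^sup>2" using power_mono[OF u_le abs_ge_zero, of n x 2] by simp
      then have "\<bar>shift_loss (u n x)\<bar> \<le> B * (C * \<bar>s n\<bar>)\<^sup>2"
        using B(2)[of "u n x"] mult_left_mono[OF _ B(1)] by (meson order_trans)
      then show "norm (shift_loss (u n x) / (s n)\<^sup>2) \<le> B * C\<^sup>2"
        using s0[of n] by (simp add: abs_divide divide_le_eq power_mult_distrib mult.assoc)
    qed
  qed auto
  then show "((\<lambda>t. (\<integral>v. mcrit (\<theta>s + t) v - mcrit \<theta>s v \<partial>Q) / t\<^sup>2) \<circ> s) \<longlonglongrightarrow> 2 * \<phi> 0 * information / 2"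
    by (simp add: comp_def excess_eq_shift_loss u_def information_eq)
qed

lemma lipschitz_M_estimation_mcrit:
  "\<exists>R. lipschitz_M_estimation P Q (\<lambda>i \<omega>. (X i \<omega>, Z i \<omega>)) mcrit psi \<theta>s C R (2 * \<phi> 0 * information)"
proof -
  obtain R where R: "0 < R" "AE v in Q. \<forall>\<theta>. R \<le> \<bar>\<theta> - \<theta>s\<bar> \<longrightarrow> mcrit \<theta> v = mcrit (\<theta>s + R) v"
    using mcrit_far by blast
  have "lipschitz_M_estimation P Q (\<lambda>i \<omega>. (X i \<omega>, Z i \<omega>)) mcrit psi \<theta>s C R (2 * \<phi> 0 * information)"
    by unfold_locales
      (use R mcrit_Lipschitz mcrit_deriv mcrit_separation mcrit_curvature phi_0_pos information_pos
        in \<open>auto simp: psi_second_moment information_def\<close>)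
  then show ?thesis ..
qed

end

theorem theorem3p4:
  fixes P :: "'w measure"
    and X Z :: "nat \<Rightarrow> 'w \<Rightarrow> real"
    and f lam \<phi> :: "real \<Rightarrow> real"
    and \<theta>s :: real
    and \<theta>hat :: "nat \<Rightarrow> 'w \<Rightarrow> real"
  assumes "basic_template_model P X Z f lam \<phi> \<theta>s (\<lambda>y. \<bar>y\<bar>)"
    and "\<exists>C. C-lipschitz_on UNIV f"
    and "\<exists>U C. open U \<and> tsupport (\<lambda>x. f (x - \<theta>s)) \<subseteq> U \<and> C-lipschitz_on U lam"
    and "isCont \<phi> 0"
    and "0 < \<phi> 0"
    and "0 < (\<integral>\<omega>. (deriv f (X 0 \<omega> - \<theta>s))\<^sup>2 \<partial>P)"
    and "\<And>n. 1 \<le> n \<Longrightarrow> \<theta>hat n \<in> borel_measurable P"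
    and "\<And>n. 1 \<le> n \<Longrightarrow>
      (AE \<omega> in P. is_arg_min (emp_crit (\<lambda>y. \<bar>y\<bar>) f X (obs_Y f \<theta>s X Z) n \<omega>) (\<lambda>_. True) (\<theta>hat n \<omega>))"
  shows "asymp_normal P (\<lambda>n \<omega>. sqrt (real n) * (\<theta>hat n \<omega> - \<theta>s)) 0
           (1 / (4 * (\<phi> 0)\<^sup>2 * (\<integral>\<omega>. (deriv f (X 0 \<omega> - \<theta>s))\<^sup>2 \<partial>P)))"
proof -
  obtain C where C: "C-lipschitz_on UNIV f" using assms(2) by blast
  interpret basic_template_model P X Z f lam \<phi> \<theta>s "\<lambda>y. \<bar>y\<bar>" by (rule assms(1))
  interpret T: lipschitz_template_model P X Z f lam \<phi> \<theta>s C
    by unfold_locales (rule C assms)+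
  obtain R where R: "lipschitz_M_estimation P T.Q (\<lambda>i \<omega>. (X i \<omega>, Z i \<omega>)) T.mcrit T.psi \<theta>s C R (2 * \<phi> 0 * T.information)"
    using T.lipschitz_M_estimation_mcrit by blast
  interpret E: lipschitz_M_estimation P T.Q "\<lambda>i \<omega>. (X i \<omega>, Z i \<omega>)" T.mcrit T.psi \<theta>s C R "2 * \<phi> 0 * T.information"
    by (rule R)
  have I: "0 < T.information" using assms(6) by (simp add: T.information_def)
  have "AE \<omega> in P. \<forall>\<theta>. (\<Sum>i<n. T.mcrit (\<theta>hat n \<omega>) (X i \<omega>, Z i \<omega>)) \<le> (\<Sum>i<n. T.mcrit \<theta> (X i \<omega>, Z i \<omega>))"
    if n: "1 \<le> n" for n
    using assms(8)[OF n]
    by eventually_elim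
      (use n in \<open>auto simp: is_arg_min_def emp_crit_def T.mcrit_sample not_less divide_le_cancel\<close>)
  from E.asymptotic_normality[OF assms(7) this]
  have "weak_conv_m (\<lambda>n. distr P borel (\<lambda>\<omega>. sqrt n * (\<theta>hat n \<omega> - \<theta>s)))
    (density lborel (\<lambda>x. ennreal (normal_density 0 (sqrt T.information / (2 * \<phi> 0 * T.information)) x)))"
    by (simp add: T.psi_second_moment)
  moreover have "sqrt T.information / (2 * \<phi> 0 * T.information) = sqrt (1 / (4 * (\<phi> 0)\<^sup>2 * T.information))"
  proof (rule real_sqrt_unique[symmetric])
    show "(sqrt T.information / (2 * \<phi> 0 * T.information))\<^sup>2 = 1 / (4 * (\<phi> 0)\<^sup>2 * T.information)"
      using I assms(5) by (simp add: power_divide power_mult_distrib power2_eq_square)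
  qed (use I assms(5) in simp)
  ultimately show ?thesis
    unfolding asymp_normal_def T.information_def by simp
qed

end
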